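(* Let $0<\alpha<2$, $n>\alpha$, and let $w\in\mathcal{L}_\alpha$ be a spherically anti-symmetric function, i.e. $$w(x)=-\frac{1}{|x|^{n-\alpha}}\,w\left(\frac{x}{|x|^2}\right)\qquad\text{for all } |x|\ge 1$$ (implying $w(x)=0$ for $|x|=1$). Denote $d(x)=\operatorname{dist}(x,\partial B_1(0))$. (1) Suppose that there exists $\bar x\in\mathbb{R}^n$ with $|\bar x|>1$ satisfying $w(\bar x)=\inf_{|x|\ge 1}w(x)\le 0$ and that $w$ is $C^{1,1}_{loc}$ at $\bar x$. Then $$(-\Delta)^{\alpha/2}w(\bar x)\le C\left(\frac{w(\bar x)}{(d(\bar x))^\alpha(1+d(\bar x))^n}+\int_{|y|>1}\big(w(\bar x)-w(y)\big)\left(\frac{1}{|\bar x-y|^{n+\alpha}}-\frac{1}{\left|\frac{\bar x}{|\bar x|}-|\bar x|y\right|^{n+\alpha}}\right)dy\right),$$ where $C=C(n,\alpha)>0$ is a constant depending only on $n$ and $\alpha$. In particular, $$(-\Delta)^{\alpha/2}w(\bar x)\le -C\int_{|y|>1}w(y)\left(\frac{1}{|\bar x-y|^{n+\alpha}}-\frac{1}{\left|\frac{\bar x}{|\bar x|}-|\bar x|y\right|^{n+\alpha}}\right)dy.$$ (2) Suppose that there exists $\bar x\in\mathbb{R}^n$ with $0<|\bar x|<1$ satisfying $w(\bar x)=\inf_{0<|x|<1}w(x)\le 0$ and that $w$ is $C^{1,1}_{loc}$ at $\bar x$. Then $$(-\Delta)^{\alpha/2}w(\bar x)\le C\left(\frac{w(\bar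 x)}{(d(\bar x))^\alpha}+\int_{|y|<1}\big(w(\bar x)-w(y)\big)\left(\frac{1}{|\bar x-y|^{n+\alpha}}-\frac{1}{\left|\frac{\bar x}{|\bar x|}-|\bar x|y\right|^{n+\alpha}}\right)dy\right),$$ where $C=C(n,\alpha)>0$ is a constant depending only on $n$ and $\alpha$.
   Context: The fractional Laplacian is $(-\Delta)^{\alpha/2}u(x)=C_{n,\alpha}\,\mathrm{P.V.}\int_{\mathbb{R}^n}\frac{u(x)-u(z)}{|x-z|^{n+\alpha}}\,dz$, where $\mathrm{P.V.}$ is the Cauchy principal value and $C_{n,\alpha}>0$ is a normalization constant. The space $\mathcal{L}_\alpha$ is the set of $u:\mathbb{R}^n\to\mathbb{R}$ with $\int_{\mathbb{R}^n}\frac{|u(x)|}{1+|x|^{n+\alpha}}\,dx<\infty$. "$w$ is $C^{1,1}_{loc}$ at $\bar x$" means $w$ is $C^{1,1}$ in a neighbourhood of $\bar x$. $B_1(0)$ is the unit ball centred at the origin. Integrals on the right-hand sides are understood as extended real numbers (the integral in the last inequality of (1) may equal $-\infty$ when $w(\bar x)<0$, in which case that inequality holds trivially). *)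

theory Defs
  imports "HOL-Analysis.Analysis"
begin

definition L_space :: "real \<Rightarrow> (real ^ 'n \<Rightarrow> real) set" where
  "L_space \<alpha> = {u. u \<in> borel_measurable lebesgue \<and>
     integrable lebesgue (\<lambda>x. \<bar>u x\<bar> / (1 + norm x powr (real CARD('n) + \<alpha>)))}"

text \<open>The parameter \<open>c\<close> is the normalization constant. The principal value is the limit of the
  integrals over complements of balls; each of these converges absolutely for
  \<open>u \<in> L_space \<alpha>\<close>, and the limit exists where \<open>u\<close> is moreover locally \<open>C\<^sup>1\<^sup>,\<^sup>1\<close>.\<close>

definition frac_laplacian :: "real \<Rightarrow> real \<Rightarrow> (real ^ 'n \<Rightarrow> real) \<Rightarrow> real ^ 'n \<Rightarrow> real" where
  "frac_laplacian c \<alpha> u x = c * Lim (at_right 0)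
     (\<lambda>\<epsilon>. LINT z:{z. \<epsilon> < norm (x - z)}|lebesgue.
        (u x - u z) / norm (x - z) powr (real CARD('n) + \<alpha>))"

definition C11_loc_at :: "('a::real_inner \<Rightarrow> real) \<Rightarrow> 'a \<Rightarrow> bool" where
  "C11_loc_at w x \<longleftrightarrow> (\<exists>U D L. open U \<and> x \<in> U \<and>
     (\<forall>y\<in>U. GDERIV w y :> D y) \<and> L-lipschitz_on U D)"

definition spherically_antisymmetric :: "real \<Rightarrow> (real ^ 'n \<Rightarrow> real) \<Rightarrow> bool" where
  "spherically_antisymmetric \<alpha> w \<longleftrightarrow> (\<forall>x. 1 \<le> norm x \<longrightarrow>
     w x = - (1 / norm x powr (real CARD('n) - \<alpha>)) * w (x /\<^sub>R (norm x)\<^sup>2))"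

definition sphere_dist :: "'a::real_normed_vector \<Rightarrow> real" where
  "sphere_dist x = infdist x (frontier (ball 0 1))"

definition refl_kernel :: "real \<Rightarrow> real ^ 'n \<Rightarrow> real ^ 'n \<Rightarrow> real" where
  "refl_kernel \<alpha> x y = 1 / norm (x - y) powr (real CARD('n) + \<alpha>)
     - 1 / norm (x /\<^sub>R norm x - norm x *\<^sub>R y) powr (real CARD('n) + \<alpha>)"

text \<open>Lebesgue integral with values in the extended reals: the integral of the positive part minus
  the integral of the negative part (\<open>ennreal\<close> maps negative reals to \<open>0\<close>). It is meaningful
  whenever one of the two is finite.\<close>

definition ereal_set_integral :: "'a::euclidean_space set \<Rightarrow> ('a \<Rightarrow> real) \<Rightarrow> ereal" where
  "ereal_set_integral S f =
     enn2ereal (\<integral>\<^sup>+y\<in>S. ennreal (f y) \<partial>lebesgue)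
     - enn2ereal (\<integral>\<^sup>+y\<in>S. ennreal (- f y) \<partial>lebesgue)"

lemma ereal_set_integral_eq_lebesgue:
  assumes "set_integrable lebesgue S f"
  shows "ereal_set_integral S f = ereal (LINT y:S|lebesgue. f y)"
proof -
  let ?g = "\<lambda>y. indicator S y *\<^sub>R f y"
  have g: "integrable lebesgue ?g"
    using assms by (simp add: set_integrable_def)
  have p: "(\<integral>\<^sup>+y\<in>S. ennreal (f y) \<partial>lebesgue) = (\<integral>\<^sup>+y. ennreal (?g y) \<partial>lebesgue)"
    by (rule nn_integral_cong) (simp split: split_indicator)
  have n: "(\<integral>\<^sup>+y\<in>S. ennreal (- f y) \<partial>lebesgue) = (\<integral>\<^sup>+y. ennreal (- ?g y) \<partial>lebesgue)"
    by (rule nn_integral_cong) (simp split: split_indicator)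
  show ?thesis
    using g
  proof (rule integrableE)
    fix r q :: real
    assume "0 \<le> r" "0 \<le> q"
      and "(\<integral>\<^sup>+y. ennreal (?g y) \<partial>lebesgue) = ennreal r"
      and "(\<integral>\<^sup>+y. ennreal (- ?g y) \<partial>lebesgue) = ennreal q"
      and "integral\<^sup>L lebesgue ?g = r - q"
    then show ?thesis
      by (simp only: ereal_set_integral_def p n set_lebesgue_integral_def enn2ereal_ennreal
          ereal_minus(1))
  qed
qed

end

theory Submission
  imports Defs
begin

text \<open>
  Write \<open>n\<close> for the dimension, \<open>N = n + \<alpha>\<close>, and let \<open>S\<close> be the side of the unit sphere
  that contains \<open>x\<close>, without the origin. Inversion in the sphere maps \<open>S\<close> onto the other side up to
  a null set, with Jacobian \<open>1 / norm y ^ (2 * n)\<close>, and it turns \<open>norm (x - y)\<close> into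
  \<open>K y / norm y\<close> with \<open>K y = norm (x /\<^sub>R norm x - norm x *\<^sub>R y)\<close>. Folding the integral that
  defines the fractional Laplacian along the inversion and using the antisymmetry of \<open>w\<close> gives, with
  integrals over \<open>S\<close> and \<open>k\<close> the reflected kernel,

  \<open>\<integral> (w x - w z) / norm (x - z) powr N = \<integral> (w x - w y) * k y + w x * \<integral> (1 + norm y powr (\<alpha> - n)) / K y powr N\<close>

  where the integral on the left is over the whole space (\<open>integral_folded\<close>). The reflected kernel is
  nonnegative because two points on the same side are closer to each other than to each other's reflections
  (\<open>norm_diff_le_conj_dist\<close>), and \<open>w x\<close> is a nonpositive minimum, so both terms on the right are
  nonpositive.

  The integral on the left converges absolutely, and is the principal value. Near \<open>x\<close> the gradient of
  \<open>w\<close> vanishes at \<open>x\<close> and is Lipschitz, so \<open>w x - w z\<close> is quadratically small and the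
  singularity is integrable; far away the decay built into the function space suffices
  (\<open>integrable_frac_laplacian_integrand\<close>). As the two terms on the right have the same sign, they converge as well.

  It remains to bound the last integral from below. Let \<open>d\<close> be the distance of \<open>x\<close> from
  the sphere. Inside \<open>S\<close>, take a ball that touches the sphere in \<open>x /\<^sub>R norm x\<close>, of radius
  \<open>d / norm x\<close> for the exterior and \<open>d / 2\<close> for the interior; on it \<open>K\<close> is at most a multiple of
  \<open>d\<close> (\<open>exterior_test_ball\<close>, \<open>interior_test_ball\<close>). So the integral is at least a
  multiple of \<open>(d / norm x) ^ n / d powr N\<close>, respectively \<open>d ^ n / d powr N\<close>, which are the weights in
  the theorem. The second exterior inequality follows by dropping the nonpositive contributions of \<open>w x\<close>
  (\<open>set_integral_le_minus_ereal_set_integral\<close>).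
\<close>

section \<open>Lebesgue measure under renaming of coordinates\<close>

text \<open>
  The theorem \<open>has_absolute_integral_change_of_variables\<close> concerns \<open>real ^ 'm\<close> with a well-ordered
  index type \<open>'m\<close>. A copy of the finite index type \<open>'n\<close>, ordered by an arbitrary enumeration, provides such a
  type, and renaming the coordinates is an isometry that preserves Lebesgue measure.
\<close>

typedef 'a well_ordered = "UNIV :: 'a set"
  morphisms of_wo to_wo by simp

lemma bij_to_wo: "bij to_wo"
  by (metis UNIV_I bijI' of_wo_inverse to_wo_inverse)

instance well_ordered :: (finite) finite
  by standard (metis bij_to_wo bij_betw_finite finite_class.finite_UNIV)

definition wo_rank :: "'a::finite well_ordered \<Rightarrow> nat" where
  "wo_rank = (SOME f. inj f)"

lemma inj_wo_rank: "inj (wo_rank :: 'a::finite well_ordered \<Rightarrow> nat)"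
proof -
  have "\<exists>f :: 'a well_ordered \<Rightarrow> nat. inj f"
    using finite_imp_inj_to_nat_seg[of "UNIV :: 'a well_ordered set"] by auto
  then show ?thesis
    unfolding wo_rank_def by (rule someI_ex)
qed

instantiation well_ordered :: (finite) wellorder
begin

definition "a \<le> b \<longleftrightarrow> wo_rank a \<le> wo_rank b" for a b :: "'a well_ordered"

definition "a < b \<longleftrightarrow> wo_rank a < wo_rank b" for a b :: "'a well_ordered"

instance
proof
  fix P :: "'a well_ordered \<Rightarrow> bool" and a
  assume step: "\<And>x. (\<And>y. y < x \<Longrightarrow> P y) \<Longrightarrow> P x"
  show "P a"
    by (induction a rule: measure_induct_rule[of wo_rank]) (rule step, simp add: less_well_ordered_def)
qed (auto simp: less_eq_well_ordered_def less_well_ordered_def inj_eq[OF inj_wo_rank])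

end

definition reindex :: "real ^ 'n::finite well_ordered \<Rightarrow> real ^ 'n" where
  "reindex v = (\<chi> i. v $ to_wo i)"

definition unreindex :: "real ^ 'n::finite \<Rightarrow> real ^ 'n well_ordered" where
  "unreindex v = (\<chi> i. v $ of_wo i)"

lemma reindex_inverse [simp]:
  "reindex (unreindex v) = v" "unreindex (reindex u) = u"
  by (simp_all add: reindex_def unreindex_def vec_eq_iff to_wo_inverse of_wo_inverse)

lemma linear_reindex: "linear reindex"
  by (intro linearI) (simp_all add: reindex_def vec_eq_iff)

lemma norm_reindex [simp]: "norm (reindex v) = norm v"
proof -
  have "(\<Sum>i\<in>UNIV. (v $ to_wo i)\<^sup>2) = (\<Sum>i\<in>UNIV. (v $ i)\<^sup>2)"
    using sum.reindex_bij_betw[OF bij_to_wo, of "\<lambda>i. (v $ i)\<^sup>2"] .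
  then show ?thesis
    by (simp add: norm_vec_def L2_set_def reindex_def)
qed

lemma measurable_reindex [measurable]: "reindex \<in> borel \<rightarrow>\<^sub>M borel"
  by (intro borel_measurable_continuous_onI linear_continuous_on linear_conv_bounded_linear[THEN iffD1] linear_reindex)

lemma lborel_distr_reindex: "distr lborel borel reindex = (lborel :: (real ^ 'n::finite) measure)"
proof (rule lborel_eqI[symmetric])
  fix l u :: "real ^ 'n"
  assume le: "\<And>b. b \<in> Basis \<Longrightarrow> l \<bullet> b \<le> u \<bullet> b"
  have le': "l $ i \<le> u $ i" for i
    using le[of "axis i 1"] by (simp add: axis_in_Basis_iff inner_axis)
  have eq: "reindex -` box l u = box (unreindex l) (unreindex u)"
  proof (rule set_eqI)
    fix v :: "real ^ 'n well_ordered"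
    have "(\<forall>i. l $ i < v $ to_wo i \<and> v $ to_wo i < u $ i)
        \<longleftrightarrow> (\<forall>j. l $ of_wo j < v $ j \<and> v $ j < u $ of_wo j)"
      by (metis UNIV_I of_wo_inverse to_wo_inverse)
    then show "v \<in> reindex -` box l u \<longleftrightarrow> v \<in> box (unreindex l) (unreindex u)"
      by (simp add: mem_box_cart reindex_def unreindex_def)
  qed
  have prodB: "(\<Prod>b\<in>Basis. (q - p) \<bullet> b) = (\<Prod>i\<in>UNIV. q $ i - p $ i)" for p q :: "real ^ 'm"
    by (simp add: Basis_vec_def UNION_singleton_eq_range prod.reindex inj_on_def axis_eq_axis inner_axis)
  have "emeasure (distr lborel borel reindex) (box l u) = emeasure lborel (box (unreindex l) (unreindex u))"
    by (simp add: emeasure_distr eq)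
  also have "\<dots> = (\<Prod>b\<in>Basis. (unreindex u - unreindex l) \<bullet> b)"
    by (rule emeasure_lborel_box) (auto simp: Basis_vec_def inner_axis unreindex_def le')
  also have "(\<Prod>b\<in>Basis. (unreindex u - unreindex l) \<bullet> b) = (\<Prod>b\<in>Basis. (u - l) \<bullet> b)"
    unfolding prodB
    using prod.reindex_bij_betw[OF bij_to_wo, of "\<lambda>i. unreindex u $ i - unreindex l $ i"]
    by (simp add: unreindex_def to_wo_inverse)
  finally show "emeasure (distr lborel borel reindex) (box l u) = (\<Prod>b\<in>Basis. (u - l) \<bullet> b)" .
qed simp

lemma linear_unreindex: "linear unreindex"
  by (intro linearI) (simp_all add: unreindex_def vec_eq_iff)

lemma measurable_unreindex [measurable]: "unreindex \<in> borel \<rightarrow>\<^sub>M borel"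
  by (intro borel_measurable_continuous_onI linear_continuous_on linear_conv_bounded_linear[THEN iffD1] linear_unreindex)

lemma lborel_distr_unreindex:
  "distr lborel borel unreindex = (lborel :: (real ^ 'n::finite well_ordered) measure)"
proof -
  have "distr lborel borel unreindex
      = distr (distr lborel borel (reindex :: real ^ 'n well_ordered \<Rightarrow> _)) borel unreindex"
    by (simp add: lborel_distr_reindex)
  also have "\<dots> = distr lborel borel id"
    by (subst distr_distr) (simp_all add: comp_def id_def)
  also have "\<dots> = lborel"
    by (simp add: id_def distr_id2)
  finally show ?thesis .
qed

text \<open>
  Passing to completions needs null sets to be pulled back to null sets, which holds because the map preserves the
  measure of Borel sets.
\<close>

lemma
  fixes f :: "'a::euclidean_space \<Rightarrow> 'b::euclidean_space"
  assumes [measurable]: "f \<in> borel \<rightarrow>\<^sub>M borel" and f: "distr lborel borel f = lborel"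
  shows lebesgue_measurable_if_distr_lborel: "f \<in> lebesgue \<rightarrow>\<^sub>M lebesgue"
    and lebesgue_distr_if_distr_lborel: "distr lebesgue lebesgue f = lebesgue"
proof -
  have "distr lebesgue lborel f = distr lborel lborel f"
    by (intro distr_completion) simp
  also have "\<dots> = lborel"
    using f by (simp cong: distr_cong)
  finally have eq: "distr lebesgue lborel f = lborel" .
  show "f \<in> lebesgue \<rightarrow>\<^sub>M lebesgue"
    by (rule completion.measurable_completion2) (simp_all add: eq measurable_completion)
  show "distr lebesgue lebesgue f = lebesgue"
    by (subst completion.completion_distr_eq[symmetric]) (simp_all add: eq measurable_completion)
qed

lemmas measurable_lebesgue_reindex = lebesgue_measurable_if_distr_lborel[OF measurable_reindex lborel_distr_reindex]
lemmas measurable_lebesgue_unreindex = lebesgue_measurable_if_distr_lborel[OF measurable_unreindex lborel_distr_unreindex]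
lemmas lebesgue_distr_reindex = lebesgue_distr_if_distr_lborel[OF measurable_reindex lborel_distr_reindex]

text \<open>
  Lebesgue measurability of \<open>f\<close> itself, and not only of its pull-back, comes from composing with the
  inverse renaming.
\<close>

lemma lebesgue_integrable_reindex_iff:
  fixes f :: "real ^ 'n::finite \<Rightarrow> real"
  shows "integrable lebesgue (\<lambda>v. f (reindex v)) \<longleftrightarrow> integrable lebesgue f"
proof
  assume i: "integrable lebesgue (\<lambda>v. f (reindex v))"
  have "(\<lambda>u. f (reindex (unreindex u))) \<in> borel_measurable lebesgue"
    using measurable_compose[OF measurable_lebesgue_unreindex borel_measurable_integrable[OF i]] .
  then have "f \<in> borel_measurable lebesgue"
    by simp
  with i show "integrable lebesgue f"
    by (metis integrable_distr_eq lebesgue_distr_reindex measurable_lebesgue_reindex)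
next
  assume "integrable lebesgue f"
  then show "integrable lebesgue (\<lambda>v. f (reindex v))"
    by (metis integrable_distr lebesgue_distr_reindex measurable_lebesgue_reindex)
qed

lemma lebesgue_integral_reindex:
  fixes f :: "real ^ 'n::finite \<Rightarrow> real"
  shows "integral\<^sup>L lebesgue (\<lambda>v. f (reindex v)) = integral\<^sup>L lebesgue f"
proof (cases "integrable lebesgue f")
  case True
  then show ?thesis
    by (metis borel_measurable_integrable integral_distr lebesgue_distr_reindex measurable_lebesgue_reindex)
next
  case False
  then show ?thesis
    by (simp add: not_integrable_integral_eq lebesgue_integrable_reindex_iff)
qed

section \<open>Inversion in the unit sphere\<close>

definition inversion :: "'a::real_inner \<Rightarrow> 'a" where
  "inversion y = y /\<^sub>R (norm y)\<^sup>2"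

lemma norm_inversion [simp]: "norm (inversion y) = 1 / norm y"
  by (simp add: inversion_def power2_eq_square divide_simps)

lemma inversion_inversion [simp]: "inversion (inversion y) = y"
  by (cases "y = 0") (simp_all add: inversion_def power2_eq_square field_simps)

lemma inversion_eq_0_iff [simp]: "inversion y = 0 \<longleftrightarrow> y = 0"
  by (simp add: inversion_def)

lemma norm_scaleR_diff_squared:
  fixes x y :: "'a::real_inner"
  shows "(norm (a *\<^sub>R x - b *\<^sub>R y))\<^sup>2 = a\<^sup>2 * (norm x)\<^sup>2 - 2 * a * b * (x \<bullet> y) + b\<^sup>2 * (norm y)\<^sup>2"
  by (simp add: power2_norm_eq_inner inner_diff_left inner_diff_right inner_commute[of y x])
    (simp add: power2_eq_square algebra_simps)

text \<open>
  The distance from \<open>x\<close> to the reflected point \<open>inversion y\<close>, times \<open>norm y\<close>, is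
  symmetric in \<open>x\<close> and \<open>y\<close>: squaring gives
  \<open>1 - 2 (x \<bullet> y) + (norm x)\<^sup>2 (norm y)\<^sup>2\<close>. It is the expression in the second term of
  the reflected kernel.
\<close>

lemma norm_diff_inversion:
  fixes x y :: "'a::real_inner"
  assumes "x \<noteq> 0" "y \<noteq> 0"
  shows "norm (x - inversion y) = norm (x /\<^sub>R norm x - norm x *\<^sub>R y) / norm y"
proof -
  have "(norm (x - inversion y))\<^sup>2 = (norm x)\<^sup>2 - 2 * (x \<bullet> y) / (norm y)\<^sup>2 + 1 / (norm y)\<^sup>2"
    using norm_scaleR_diff_squared[of 1 x "inverse ((norm y)\<^sup>2)" y] assms
    by (simp add: inversion_def divide_inverse power2_eq_square) (simp add: field_simps)
  also have "\<dots> = (norm (x /\<^sub>R norm x - norm x *\<^sub>R y) / norm y)\<^sup>2"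
    unfolding power_divide norm_scaleR_diff_squared
    using assms by (simp add: field_simps)
  finally have "(norm (x - inversion y))\<^sup>2 = (norm (x /\<^sub>R norm x - norm x *\<^sub>R y) / norm y)\<^sup>2" .
  then show ?thesis
    by (rule power2_eq_imp_eq) simp_all
qed

definition reflection :: "'a::real_inner \<Rightarrow> 'a \<Rightarrow> 'a" where
  "reflection y h = h - (2 * (y \<bullet> h) / (norm y)\<^sup>2) *\<^sub>R y"

lemma orthogonal_transformation_reflection:
  "orthogonal_transformation (reflection y)"
  unfolding orthogonal_transformation
proof
  show "linear (reflection y)"
    by (intro linearI) (simp_all add: reflection_def inner_add_right algebra_simps add_divide_distrib)
  have "(norm (reflection y h))\<^sup>2 = (norm h)\<^sup>2" for h
    using norm_scaleR_diff_squared[of 1 h "2 * (y \<bullet> h) / (norm y)\<^sup>2" y]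
    by (cases "y = 0") (simp_all add: reflection_def inner_commute[of h y] field_simps power2_eq_square)
  then show "\<forall>h. norm (reflection y h) = norm h"
    by (metis norm_ge_zero power2_eq_imp_eq)
qed

text \<open>
  Inversion is conformal: its derivative at \<open>y\<close> is the reflection in the hyperplane orthogonal to
  \<open>y\<close>, scaled by \<open>1 / (norm y)\<^sup>2\<close>. As a reflection is orthogonal, the Jacobian
  determinant is a pure power of \<open>norm y\<close>.
\<close>

lemma has_derivative_inversion:
  assumes "y \<noteq> 0"
  shows "(inversion has_derivative (\<lambda>h. (1 / (norm y)\<^sup>2) *\<^sub>R reflection y h)) (at y within S)"
proof -
  have "((\<lambda>y. inverse (y \<bullet> y) *\<^sub>R y) has_derivative
      (\<lambda>h. inverse (y \<bullet> y) *\<^sub>R h + (- (inverse (y \<bullet> y) * (y \<bullet> h + h \<bullet> y) * inverse (y \<bullet> y))) *\<^sub>R y)) (at y within S)"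
    using assms by (intro derivative_eq_intros | simp)+
  moreover have "(\<lambda>h. inverse (y \<bullet> y) *\<^sub>R h + (- (inverse (y \<bullet> y) * (y \<bullet> h + h \<bullet> y) * inverse (y \<bullet> y))) *\<^sub>R y)
      = (\<lambda>h. (1 / (norm y)\<^sup>2) *\<^sub>R reflection y h)"
    by (simp add: fun_eq_iff reflection_def power2_norm_eq_inner algebra_simps inner_commute divide_inverse)
  ultimately show ?thesis
    by (simp add: inversion_def[abs_def] power2_norm_eq_inner)
qed

lemma abs_det_inversion:
  fixes y :: "real ^ 'n::finite"
  shows "\<bar>det (matrix (\<lambda>h. (1 / (norm y)\<^sup>2) *\<^sub>R reflection y h))\<bar> = 1 / norm y ^ (2 * CARD('n))"
proof -
  have lin: "linear (reflection y)" and orth: "orthogonal_matrix (matrix (reflection y))"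
    using orthogonal_transformation_reflection[of y] by (auto simp: orthogonal_transformation_matrix orthogonal_transformation_linear)
  have "matrix (\<lambda>h. (1 / (norm y)\<^sup>2) *\<^sub>R reflection y h) = matrix ((*\<^sub>R) (1 / (norm y)\<^sup>2)) ** matrix (reflection y)"
    using matrix_compose[OF lin, of "(*\<^sub>R) (1 / (norm y)\<^sup>2)"] linear_scale_self by (simp add: comp_def)
  moreover have "\<bar>det (matrix (reflection y))\<bar> = 1"
    using det_orthogonal_matrix[OF orth] by auto
  ultimately show ?thesis
    by (simp add: det_mul abs_mult power_mult power_divide)
qed

lemma
  fixes f :: "real ^ 'n::{finite,wellorder} \<Rightarrow> real"
  assumes S: "S \<in> sets lebesgue" "0 \<notin> S" and f: "set_integrable lebesgue (inversion ` S) f"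
  shows set_integrable_inversion_wo:
      "set_integrable lebesgue S (\<lambda>y. f (inversion y) / norm y ^ (2 * CARD('n)))"
    and set_lebesgue_integral_inversion_wo:
      "(LINT z:inversion ` S|lebesgue. f z) = (LINT y:S|lebesgue. f (inversion y) / norm y ^ (2 * CARD('n)))"
proof -
  let ?g = "\<lambda>y. f (inversion y) / norm y ^ (2 * CARD('n))"
  have inj: "inj_on inversion S"
    by (metis inj_onI inversion_inversion)
  have der: "(inversion has_derivative (\<lambda>h. (1 / (norm y)\<^sup>2) *\<^sub>R reflection y h)) (at y within S)" if "y \<in> S" for y
    using that S by (intro has_derivative_inversion) auto
  \<comment> \<open>The change of variables theorem takes vector-valued integrands, hence the detour through \<open>real ^ 1\<close>.\<close>
  have "(\<lambda>y. \<bar>det (matrix (\<lambda>h. (1 / (norm y)\<^sup>2) *\<^sub>R reflection y h))\<bar> *\<^sub>R (vec (f (inversion y)) :: real ^ 1)) absolutely_integrable_on S \<and>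
    integral S (\<lambda>y. \<bar>det (matrix (\<lambda>h. (1 / (norm y)\<^sup>2) *\<^sub>R reflection y h))\<bar> *\<^sub>R (vec (f (inversion y)) :: real ^ 1)) = vec (integral (inversion ` S) f)"
    using f by (intro has_absolute_integral_change_of_variables[OF S(1) der inj, THEN iffD2])
      (simp_all add: absolutely_integrable_on_1_iff integral_on_1_eq)
  then have *: "set_integrable lebesgue S ?g \<and> integral S ?g = integral (inversion ` S) f"
    unfolding abs_det_inversion by (simp add: absolutely_integrable_on_1_iff integral_on_1_eq)
  then show "set_integrable lebesgue S ?g"
    by blast
  show "(LINT z:inversion ` S|lebesgue. f z) = (LINT y:S|lebesgue. ?g y)"
    using * f by (simp add: set_lebesgue_integral_eq_integral)
qed

lemma reindex_inversion: "reindex (inversion v) = inversion (reindex v)"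
  by (simp add: inversion_def linear_scale[OF linear_reindex])

lemma CARD_well_ordered [simp]: "CARD('a well_ordered) = CARD('a)"
  using bij_betw_same_card[OF bij_to_wo] by metis

lemma
  fixes f :: "real ^ 'n::finite \<Rightarrow> real"
  shows set_integrable_reindex_iff:
      "set_integrable lebesgue (reindex -` A) (\<lambda>v. f (reindex v)) \<longleftrightarrow> set_integrable lebesgue A f"
    and set_lebesgue_integral_reindex:
      "(LINT v:reindex -` A|lebesgue. f (reindex v)) = (LINT u:A|lebesgue. f u)"
  using lebesgue_integrable_reindex_iff[of "\<lambda>u. indicator A u *\<^sub>R f u"]
    lebesgue_integral_reindex[of "\<lambda>u. indicator A u *\<^sub>R f u"]
  by (simp_all add: set_integrable_def set_lebesgue_integral_def indicator_def)

text \<open>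
  Being linear and isometric, the renaming of coordinates commutes with the inversion, which transfers the formula to
  an arbitrary finite index type.
\<close>

lemma
  fixes f :: "real ^ 'n::finite \<Rightarrow> real"
  assumes S: "S \<in> sets lebesgue" "0 \<notin> S" and f: "set_integrable lebesgue (inversion ` S) f"
  shows set_integrable_inversion:
      "set_integrable lebesgue S (\<lambda>y. f (inversion y) / norm y ^ (2 * CARD('n)))"
    and set_lebesgue_integral_inversion:
      "(LINT z:inversion ` S|lebesgue. f z) = (LINT y:S|lebesgue. f (inversion y) / norm y ^ (2 * CARD('n)))"
proof -
  let ?S = "reindex -` S :: (real ^ 'n well_ordered) set"
  let ?f = "\<lambda>v. f (reindex v)"
  have S': "?S \<in> sets lebesgue" "0 \<notin> ?S"
    using measurable_sets[OF measurable_lebesgue_reindex S(1)] S(2)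
    by (simp_all add: linear_0[OF linear_reindex])
  have img: "inversion ` ?S = reindex -` (inversion ` S)"
  proof safe
    fix v y assume "reindex v = inversion y" "y \<in> S"
    then have "v = inversion (inversion v)" "inversion v \<in> ?S"
      by (simp_all add: reindex_inversion)
    then show "v \<in> inversion ` ?S"
      by blast
  qed (simp add: reindex_inversion)
  have f': "set_integrable lebesgue (inversion ` ?S) ?f"
    using f unfolding img set_integrable_reindex_iff .
  let ?g = "\<lambda>y. f (inversion y) / norm y ^ (2 * CARD('n))"
  have eq: "?f (inversion v) / norm v ^ (2 * CARD('n well_ordered)) = ?g (reindex v)" for v
    by (simp add: reindex_inversion)
  show "set_integrable lebesgue S ?g"
    using set_integrable_inversion_wo[OF S' f'] set_integrable_reindex_iff[of S ?g]
    unfolding eq by simp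
  show "(LINT z:inversion ` S|lebesgue. f z) = (LINT y:S|lebesgue. ?g y)"
    using set_lebesgue_integral_inversion_wo[OF S' f'] set_lebesgue_integral_reindex[of S ?g]
    unfolding img eq set_lebesgue_integral_reindex by simp
qed

section \<open>Integrability of powers of the distance\<close>

lemma powr_le_on_dyadic_shell:
  fixes a p t :: real
  assumes "0 < a" "a / 2 \<le> t" "t \<le> a"
  shows "1 / t powr p \<le> 2 powr \<bar>p\<bar> * a powr (- p)"
proof -
  have t: "0 < t" using assms by linarith
  have "1 / t powr p = (a / t) powr p * a powr (- p)"
    using assms t by (simp add: powr_divide powr_minus field_simps)
  moreover have "(a / t) powr p \<le> (a / t) powr \<bar>p\<bar>"
    using assms t by (intro powr_mono) (simp_all add: field_simps)
  moreover have "(a / t) powr \<bar>p\<bar> \<le> 2 powr \<bar>p\<bar>"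
    using assms t by (intro powr_mono2) (simp_all add: field_simps)
  ultimately show ?thesis
    by (metis mult_right_mono order_trans powr_ge_zero)
qed

lemma obtain_dyadic_shell:
  fixes r t :: real
  assumes "0 < t" "t < r"
  obtains k :: nat where "r * (1/2) ^ k / 2 \<le> t" "t < r * (1/2) ^ k"
proof -
  have "\<exists>k. r * (1/2) ^ k \<le> t"
  proof -
    obtain k where "(1/2) ^ k < t / r"
      using real_arch_pow_inv[of "t / r" "1/2"] assms by auto
    then show ?thesis
      using assms by (intro exI[of _ k]) (simp add: field_simps)
  qed
  define m where "m = (LEAST k. r * (1/2) ^ k \<le> t)"
  have m: "r * (1/2) ^ m \<le> t"
    unfolding m_def using \<open>\<exists>k. _\<close> by (rule LeastI_ex)
  have "m \<noteq> 0"
    using m assms by (intro notI) simp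
  then obtain k where k: "m = Suc k"
    by (cases m) auto
  have "\<not> r * (1/2) ^ k \<le> t"
    using not_less_Least[of k "\<lambda>k. r * (1/2) ^ k \<le> t"] k unfolding m_def by simp
  with m k show thesis
    by (intro that[of k]) (simp_all add: field_simps)
qed

text \<open>
  The ball is covered by dyadic shells. On the shell of radius \<open>r / 2 ^ k\<close> the integrand is at most a
  constant times \<open>(r / 2 ^ k) powr (- p)\<close>, and the shell has volume at most a constant times
  \<open>(r / 2 ^ k) ^ DIM('a)\<close>; for \<open>p < DIM('a)\<close> the products are the terms of a convergent
  geometric series. The exponent \<open>p\<close> may be negative, which is why the constant on a shell involves
  \<open>\<bar>p\<bar>\<close>.
\<close>

lemma set_integrable_norm_powr_ball:
  fixes x :: "'a::euclidean_space"
  assumes p: "p < real DIM('a)" and r: "0 < r"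
  shows "set_integrable lebesgue (ball x r) (\<lambda>z. 1 / norm (x - z) powr p)"
proof -
  define a where "a k = r * (1/2) ^ k" for k :: nat
  define B where "B k = 2 powr \<bar>p\<bar> * a k powr (- p)" for k
  define \<omega> where "\<omega> = measure lborel (ball (0::'a) 1)"
  define q where "q = 2 powr (p - real DIM('a))"
  have a: "0 < a k" for k
    using r by (simp add: a_def)
  have q: "0 < q" "q < 1"
    using p powr_less_mono[of "p - real DIM('a)" 0 2] by (simp_all add: q_def)
  have half: "((1/2::real) ^ k) powr s = (2 powr (- s)) ^ k" for k s
  proof -
    have "(1/2::real) ^ k = 2 powr (- real k)"
      by (simp add: powr_minus powr_realpow power_one_over inverse_eq_divide)
    then show ?thesis
      by (simp add: powr_powr powr_realpow[symmetric] mult.commute)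
  qed
  have shell: "B k * (\<omega> * a k ^ DIM('a)) = 2 powr \<bar>p\<bar> * \<omega> * r powr (real DIM('a) - p) * q ^ k" for k
  proof -
    have "a k powr (- p) * a k ^ DIM('a) = a k powr (real DIM('a) - p)"
      using a[of k] by (simp add: powr_realpow[symmetric] flip: powr_add)
    also have "\<dots> = r powr (real DIM('a) - p) * q ^ k"
      using r by (simp add: a_def powr_mult half q_def)
    finally show ?thesis
      by (simp add: B_def algebra_simps)
  qed
  have sum: "summable (\<lambda>k. B k * (\<omega> * a k ^ DIM('a)))"
    unfolding shell using q by (intro summable_mult summable_geometric) simp
  have vol: "emeasure lebesgue (ball x (a k)) = ennreal (\<omega> * a k ^ DIM('a))" for k
  proof -
    have "emeasure lebesgue (ball x (a k)) = ennreal (measure lborel (ball x (a k)))"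
      using emeasure_lborel_ball_finite[of x "a k"] emeasure_eq_ennreal_measure[of lborel "ball x (a k)"] by simp
    then show ?thesis
      using content_ball_conv_unit_ball[of "a k" x] a[of k] by (simp add: \<omega>_def mult.commute)
  qed
  have single: "h k \<le> (\<Sum>k. h k)" for h :: "nat \<Rightarrow> ennreal" and k
    using sum_le_suminf[of h "{k}"] by simp
  have le: "ennreal (indicator (ball x r) z * (1 / norm (x - z) powr p))
      \<le> (\<Sum>k. ennreal (B k) * indicator (ball x (a k)) z)" for z
  proof (cases "z \<in> ball x r \<and> z \<noteq> x")
    case True
    then obtain k where k: "a k / 2 \<le> norm (x - z)" "norm (x - z) < a k"
      using obtain_dyadic_shell[of "norm (x - z)" r] unfolding a_def by (auto simp: dist_norm)
    then have "ennreal (indicator (ball x r) z * (1 / norm (x - z) powr p)) \<le> ennreal (B k) * indicator (ball x (a k)) z"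
      using powr_le_on_dyadic_shell[OF a[of k], of "norm (x - z)" p] True
      by (auto simp: B_def dist_norm intro!: ennreal_leI)
    also have "\<dots> \<le> (\<Sum>k. ennreal (B k) * indicator (ball x (a k)) z)"
      by (rule single)
    finally show ?thesis .
  qed auto
  have "(\<integral>\<^sup>+z. ennreal (indicator (ball x r) z * (1 / norm (x - z) powr p)) \<partial>lebesgue)
      \<le> (\<integral>\<^sup>+z. (\<Sum>k. ennreal (B k) * indicator (ball x (a k)) z) \<partial>lebesgue)"
    by (intro nn_integral_mono le)
  also have "\<dots> = (\<Sum>k. ennreal (B k) * emeasure lebesgue (ball x (a k)))"
    by (subst nn_integral_suminf)
      (auto simp: nn_integral_cmult_indicator intro!: borel_measurable_times_ennreal borel_measurable_indicator)
  also have "\<dots> = (\<Sum>k. ennreal (B k * (\<omega> * a k ^ DIM('a))))"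
    unfolding vol by (intro suminf_cong ennreal_mult[symmetric]) (simp_all add: B_def \<omega>_def a less_imp_le)
  also have "\<dots> = ennreal (\<Sum>k. B k * (\<omega> * a k ^ DIM('a)))"
    by (intro suminf_ennreal2 sum) (simp add: B_def \<omega>_def a less_imp_le)
  finally have fin: "(\<integral>\<^sup>+z. ennreal (indicator (ball x r) z * (1 / norm (x - z) powr p)) \<partial>lebesgue) < \<infinity>"
    by (simp add: le_less_trans)
  show ?thesis
    unfolding set_integrable_def
  proof (rule integrableI_nonneg)
    have "(\<lambda>z. 1 / norm (x - z) powr p) \<in> borel_measurable borel"
      by measurable
    then have "(\<lambda>z. indicator (ball x r) z *\<^sub>R (1 / norm (x - z) powr p)) \<in> borel_measurable borel"
      by (intro borel_measurable_scaleR borel_measurable_indicator) simp_all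
    then show "(\<lambda>z. indicator (ball x r) z *\<^sub>R (1 / norm (x - z) powr p)) \<in> borel_measurable lebesgue"
      by (intro measurable_completion) simp
  qed (use fin in \<open>simp_all\<close>)
qed

lemma inversion_exterior: "inversion ` {y :: 'a::real_inner. 1 < norm y} = ball 0 1 - {0}"
proof
  show "ball 0 1 - {0} \<subseteq> inversion ` {y :: 'a. 1 < norm y}"
  proof
    fix z :: 'a assume "z \<in> ball 0 1 - {0}"
    then show "z \<in> inversion ` {y. 1 < norm y}"
      by (intro image_eqI[of _ _ "inversion z"]) (simp_all add: field_simps)
  qed
qed (auto simp: divide_simps)

lemma inversion_punctured_ball: "inversion ` (ball 0 1 - {0}) = {y :: 'a::real_inner. 1 < norm y}"
  unfolding inversion_exterior[symmetric] by (simp add: image_image)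

text \<open>
  Inversion carries the exterior domain to the punctured ball and turns the exponent \<open>p\<close> into
  \<open>2 * CARD('n) - p\<close>, so that integrability at infinity reduces to integrability at the origin.
\<close>

lemma set_integrable_norm_powr_exterior:
  assumes p: "real CARD('n::finite) < p"
  shows "set_integrable lebesgue {y :: real ^ 'n. 1 < norm y} (\<lambda>y. 1 / norm y powr p)"
proof -
  let ?S = "{y :: real ^ 'n. 1 < norm y}"
  have S: "?S \<in> sets lebesgue"
    by (intro sets_completionI_sets) (simp add: borel_measurable_norm)
  have "set_integrable lebesgue (ball 0 1) (\<lambda>z :: real ^ 'n. 1 / norm (0 - z) powr (2 * CARD('n) - p))"
    using p by (intro set_integrable_norm_powr_ball) simp_all
  then have "set_integrable lebesgue (inversion ` ?S) (\<lambda>z :: real ^ 'n. 1 / norm z powr (2 * CARD('n) - p))"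
    unfolding inversion_exterior diff_0 norm_minus_cancel by (rule set_integrable_subset) auto
  from set_integrable_inversion[OF S _ this]
  have "set_integrable lebesgue ?S (\<lambda>y. 1 / (1 / norm y) powr (2 * CARD('n) - p) / norm y ^ (2 * CARD('n)))"
    by simp
  moreover have "1 / (1 / norm y) powr (2 * CARD('n) - p) / norm y ^ (2 * CARD('n)) = 1 / norm y powr p"
    if "y \<in> ?S" for y
  proof -
    have y: "0 < norm y" using that by auto
    have "1 / (1 / norm y) powr (2 * CARD('n) - p) / norm y ^ (2 * CARD('n))
        = norm y powr (2 * CARD('n) - p) / norm y powr (2 * CARD('n))"
      using y powr_realpow[OF y, of "2 * CARD('n)"] by (simp add: powr_divide)
    also have "\<dots> = 1 / norm y powr p"
      using y by (simp add: powr_diff)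
    finally show ?thesis .
  qed
  ultimately show ?thesis
    by (subst set_integrable_cong[OF refl refl, symmetric]) auto
qed

section \<open>The fractional Laplacian at a local minimum\<close>

text \<open>
  The gradient vanishes at a local minimum, and it is Lipschitz near \<open>x\<close>; hence it is at most
  \<open>L * norm (x - y)\<close> on the ball through \<open>y\<close>, and the mean value inequality gives the quadratic
  bound.
\<close>

lemma C11_local_min_quadratic_bound:
  fixes w :: "'a::real_inner \<Rightarrow> real"
  assumes w: "C11_loc_at w x" and V: "open V" "x \<in> V" "\<And>y. y \<in> V \<Longrightarrow> w x \<le> w y"
  obtains r L where "0 < r" "0 \<le> L" "\<And>y. y \<in> ball x r \<Longrightarrow> \<bar>w x - w y\<bar> \<le> L * (norm (x - y))\<^sup>2"
proof -
  obtain U D L where U: "open U" "x \<in> U" and D: "\<And>y. y \<in> U \<Longrightarrow> GDERIV w y :> D y"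
    and L: "L-lipschitz_on U D"
    using w unfolding C11_loc_at_def by blast
  have der: "(w has_derivative (\<lambda>h. h \<bullet> D y)) (at y)" if "y \<in> U" for y
    using D[OF that] by (simp add: gderiv_def)
  have "(\<lambda>h. h \<bullet> D x) = (\<lambda>h. 0)"
    using differential_zero_maxmin[OF V(2,1) der[OF U(2)]] V(3) by blast
  then have "D x \<bullet> D x = 0"
    by meson
  then have Dx: "D x = 0"
    by simp
  obtain r where r: "0 < r" "ball x r \<subseteq> U"
    using U open_contains_ball by blast
  have "\<bar>w x - w y\<bar> \<le> L * (norm (x - y))\<^sup>2" if y: "y \<in> ball x r" for y
  proof -
    let ?B = "cball x (norm (x - y))"
    have sub: "?B \<subseteq> U"
      using y r(2) subset_trans[of ?B "ball x r" U] by (auto simp: dist_norm)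
    have "norm (w x - w y) \<le> (L * norm (x - y)) * norm (x - y)"
    proof (rule differentiable_bound[of ?B w "\<lambda>y h. h \<bullet> D y"])
      fix z assume z: "z \<in> ?B"
      then have "z \<in> U" using sub by blast
      then show "(w has_derivative (\<lambda>h. h \<bullet> D z)) (at z within ?B)"
        by (rule has_derivative_at_withinI[OF der])
      have "norm (D z) \<le> L * norm (x - z)"
        using lipschitz_onD[OF L \<open>z \<in> U\<close> U(2)] by (simp add: Dx dist_norm norm_minus_commute)
      also have "\<dots> \<le> L * norm (x - y)"
        using z lipschitz_on_nonneg[OF L] by (intro mult_left_mono) (simp_all add: dist_norm)
      finally have Dz: "norm (D z) \<le> L * norm (x - y)" .
      show "onorm (\<lambda>h. h \<bullet> D z) \<le> L * norm (x - y)"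
      proof (rule onorm_bound)
        show "0 \<le> L * norm (x - y)"
          using lipschitz_on_nonneg[OF L] by simp
        fix h
        have "norm (h \<bullet> D z) \<le> norm h * norm (D z)"
          using Cauchy_Schwarz_ineq2 by simp
        also have "\<dots> \<le> norm h * (L * norm (x - y))"
          using Dz by (intro mult_left_mono) simp_all
        finally show "norm (h \<bullet> D z) \<le> L * norm (x - y) * norm h"
          by (simp add: mult.commute)
      qed
    qed (simp_all add: dist_norm)
    then show ?thesis
      by (simp add: power2_eq_square mult.assoc)
  qed
  then show thesis
    using that r(1) lipschitz_on_nonneg[OF L] by blast
qed

lemma integrable_weight:
  assumes "real CARD('n::finite) < p"
  shows "integrable lebesgue (\<lambda>z :: real ^ 'n. 1 / (1 + norm z powr p))"
proof -
  let ?E = "{y :: real ^ 'n. 1 < norm y}"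
  have i: "integrable lebesgue (\<lambda>z :: real ^ 'n. indicator (cball 0 1) z + indicator ?E z *\<^sub>R (1 / norm z powr p))"
    using set_integrable_norm_powr_exterior[OF assms] lmeasurable_cball[of "0 :: real ^ 'n" 1]
    by (intro Bochner_Integration.integrable_add integrable_real_indicator) (simp_all add: set_integrable_def fmeasurable_def)
  have m: "(\<lambda>z :: real ^ 'n. 1 / (1 + norm z powr p)) \<in> borel_measurable borel"
    by measurable
  show ?thesis
  proof (rule Bochner_Integration.integrable_bound[OF i])
    show "(\<lambda>z :: real ^ 'n. 1 / (1 + norm z powr p)) \<in> borel_measurable lebesgue"
      using m by (intro measurable_completion) simp
    show "AE z :: real ^ 'n in lebesgue. norm (1 / (1 + norm z powr p))
        \<le> norm (indicator (cball 0 1) z + indicator ?E z *\<^sub>R (1 / norm z powr p))"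
    proof (rule AE_I2)
      fix z :: "real ^ 'n"
      show "norm (1 / (1 + norm z powr p)) \<le> norm (indicator (cball 0 1) z + indicator ?E z *\<^sub>R (1 / norm z powr p))"
      proof (cases "norm z \<le> 1")
        case True
        then show ?thesis by (simp add: add_pos_nonneg)
      next
        case False
        then have "0 < norm z powr p" by auto
        with False show ?thesis by (simp add: add_pos_pos frac_le)
      qed
    qed
  qed
qed

text \<open>
  Off a ball around \<open>x\<close>, the distance to \<open>x\<close> dominates a multiple of \<open>1 + norm z\<close>, so
  that the kernel is comparable with the weight that defines the space.
\<close>

lemma L_space_integrable_kernel_away:
  fixes w :: "real ^ 'n::finite \<Rightarrow> real"
  assumes \<alpha>: "0 < \<alpha>" and w: "w \<in> L_space \<alpha>" and r: "0 < r"
  shows "set_integrable lebesgue (- ball x r) (\<lambda>z. (a - w z) / norm (x - z) powr (real CARD('n) + \<alpha>))"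
proof -
  let ?N = "real CARD('n) + \<alpha>"
  have [measurable]: "w \<in> borel_measurable lebesgue"
    using w by (simp add: L_space_def)
  define M where "M = (1 / r) powr ?N + (norm x / r + 1) powr ?N"
  have "integrable lebesgue (\<lambda>z. M * (\<bar>a\<bar> * (1 / (1 + norm z powr ?N)) + \<bar>w z\<bar> / (1 + norm z powr ?N)))"
    using w \<alpha> unfolding L_space_def
    by (intro Bochner_Integration.integrable_mult_right Bochner_Integration.integrable_add integrable_weight) simp_all
  then show ?thesis
    unfolding set_integrable_def
  proof (rule Bochner_Integration.integrable_bound)
    have "(\<lambda>z. norm (x - z) powr ?N) \<in> borel_measurable borel"
      by measurable
    then have "(\<lambda>z. norm (x - z) powr ?N) \<in> borel_measurable lebesgue"
      by (intro measurable_completion) simp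
    moreover have "- ball x r \<in> sets lebesgue"
      by (intro sets_completionI_sets) simp
    ultimately show "(\<lambda>z. indicator (- ball x r) z *\<^sub>R ((a - w z) / norm (x - z) powr ?N)) \<in> borel_measurable lebesgue"
      by (intro borel_measurable_scaleR borel_measurable_indicator borel_measurable_divide borel_measurable_diff) simp_all
    show "AE z in lebesgue. norm (indicator (- ball x r) z *\<^sub>R ((a - w z) / norm (x - z) powr ?N))
        \<le> norm (M * (\<bar>a\<bar> * (1 / (1 + norm z powr ?N)) + \<bar>w z\<bar> / (1 + norm z powr ?N)))"
    proof (rule AE_I2)
      fix z
      have M: "0 \<le> M" by (simp add: M_def)
      show "norm (indicator (- ball x r) z *\<^sub>R ((a - w z) / norm (x - z) powr ?N))
        \<le> norm (M * (\<bar>a\<bar> * (1 / (1 + norm z powr ?N)) + \<bar>w z\<bar> / (1 + norm z powr ?N)))"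
      proof (cases "z \<in> ball x r")
        case False
        define t where "t = norm (x - z)"
        have "r \<le> t" using False by (simp add: t_def dist_norm)
        then have t: "r \<le> t" "0 < t" using r by simp_all
        \<comment> \<open>The two summands of \<open>M\<close> bound \<open>1\<close> and \<open>norm z powr ?N\<close> separately.\<close>
        have "1 \<le> (t / r) powr ?N"
          using t r \<alpha> by (intro ge_one_powr_ge_zero) simp_all
        also have "\<dots> = (1 / r) powr ?N * t powr ?N"
          using t r by (simp add: powr_divide)
        finally have 1: "1 \<le> (1 / r) powr ?N * t powr ?N" .
        have "norm z \<le> norm x + t"
          unfolding t_def by norm
        also have "norm x \<le> norm x / r * t"
          using t r mult_left_mono[of r t "norm x / r"] by simp
        finally have "norm z \<le> (norm x / r + 1) * t"
          by (simp add: algebra_simps)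
        then have "norm z powr ?N \<le> ((norm x / r + 1) * t) powr ?N"
          using \<alpha> by (intro powr_mono2) simp_all
        also have "\<dots> = (norm x / r + 1) powr ?N * t powr ?N"
          using t r by (intro powr_mult) 
        finally have "1 + norm z powr ?N \<le> M * t powr ?N"
          using 1 by (simp add: M_def algebra_simps)
        then have 2: "1 / t powr ?N \<le> M / (1 + norm z powr ?N)"
          using t by (simp add: divide_simps add_pos_nonneg mult.commute)
        have "\<bar>a - w z\<bar> * (1 / t powr ?N) \<le> (\<bar>a\<bar> + \<bar>w z\<bar>) * (M / (1 + norm z powr ?N))"
          using 2 by (intro mult_mono) simp_all
        moreover have "norm (M * (\<bar>a\<bar> * (1 / (1 + norm z powr ?N)) + \<bar>w z\<bar> / (1 + norm z powr ?N)))
           = (\<bar>a\<bar> + \<bar>w z\<bar>) * (M / (1 + norm z powr ?N))"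
          using M by (simp add: abs_mult add_divide_distrib[symmetric] add_nonneg_nonneg)
        ultimately show ?thesis
          using False by (simp add: t_def abs_divide)
      qed simp
    qed
  qed
qed

definition frac_laplacian_integrand :: "real \<Rightarrow> (real ^ 'n \<Rightarrow> real) \<Rightarrow> real ^ 'n \<Rightarrow> real ^ 'n \<Rightarrow> real" where
  "frac_laplacian_integrand \<alpha> w x z = (w x - w z) / norm (x - z) powr (real CARD('n) + \<alpha>)"

text \<open>
  At a local minimum the quadratic bound makes the singularity of order \<open>n + \<alpha> - 2 < n\<close>, so the
  integrand is absolutely integrable without any cancellation, and the principal value is an ordinary integral.
\<close>

lemma integrable_frac_laplacian_integrand:
  fixes w :: "real ^ 'n::finite \<Rightarrow> real"
  assumes \<alpha>: "0 < \<alpha>" "\<alpha> < 2" and w: "w \<in> L_space \<alpha>" "C11_loc_at w x"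
    and V: "open V" "x \<in> V" "\<And>y. y \<in> V \<Longrightarrow> w x \<le> w y"
  shows "integrable lebesgue (frac_laplacian_integrand \<alpha> w x)"
proof -
  let ?N = "real CARD('n) + \<alpha>"
  let ?F = "\<lambda>z. (w x - w z) / norm (x - z) powr ?N"
  obtain r L where r: "0 < r" and L: "0 \<le> L" "\<And>y. y \<in> ball x r \<Longrightarrow> \<bar>w x - w y\<bar> \<le> L * (norm (x - y))\<^sup>2"
    using C11_local_min_quadratic_bound[OF w(2) V] by blast
  have wm: "w \<in> borel_measurable lebesgue"
    using w by (simp add: L_space_def)
  have "(\<lambda>z. norm (x - z) powr ?N) \<in> borel_measurable borel"
    by measurable
  then have "(\<lambda>z. norm (x - z) powr ?N) \<in> borel_measurable lebesgue"
    by (intro measurable_completion) simp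
  then have F: "?F \<in> borel_measurable lebesgue"
    using wm by (intro borel_measurable_divide borel_measurable_diff) simp_all
  have near: "set_integrable lebesgue (ball x r) ?F"
  proof (rule set_integrable_bound)
    show "set_integrable lebesgue (ball x r) (\<lambda>z. L * (1 / norm (x - z) powr (?N - 2)))"
      using \<alpha> r by (intro set_integrable_mult_right set_integrable_norm_powr_ball) simp_all
    show "set_borel_measurable lebesgue (ball x r) ?F"
      unfolding set_borel_measurable_def using F by (intro borel_measurable_scaleR borel_measurable_indicator) simp_all
    show "AE z in lebesgue. z \<in> ball x r \<longrightarrow> norm (?F z) \<le> norm (L * (1 / norm (x - z) powr (?N - 2)))"
    proof (intro AE_I2 impI)
      fix z assume z: "z \<in> ball x r"
      show "norm (?F z) \<le> norm (L * (1 / norm (x - z) powr (?N - 2)))"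
      proof (cases "z = x")
        case False
        then have t: "0 < norm (x - z)" by simp
        have "norm (?F z) \<le> L * (norm (x - z))\<^sup>2 / norm (x - z) powr ?N"
          using L(2)[OF z] by (simp add: abs_divide divide_right_mono)
        also have "\<dots> = L * (1 / norm (x - z) powr (?N - 2))"
          using t by (simp add: powr_diff powr_numeral)
        finally show ?thesis
          using L(1) by simp
      qed simp
    qed
  qed
  have "set_integrable lebesgue (ball x r \<union> - ball x r) ?F"
    by (rule set_integrable_Un[OF near L_space_integrable_kernel_away[OF \<alpha>(1) w(1) r]])
      (auto intro: sets_completionI_sets)
  then show ?thesis
    by (simp add: set_integrable_def frac_laplacian_integrand_def[abs_def])
qed

lemma frac_laplacian_eq_integral:
  fixes w :: "real ^ 'n::finite \<Rightarrow> real"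
  assumes F: "integrable lebesgue (frac_laplacian_integrand \<alpha> w x)"
  shows "frac_laplacian c \<alpha> w x = c * integral\<^sup>L lebesgue (frac_laplacian_integrand \<alpha> w x)"
proof -
  let ?F = "frac_laplacian_integrand \<alpha> w x"
  have "((\<lambda>\<epsilon>. LINT z:{z. \<epsilon> < norm (x - z)}|lebesgue. ?F z) \<longlongrightarrow> integral\<^sup>L lebesgue ?F) (at_right 0)"
  proof (rule tendsto_at_right_sequentially[of _ 1])
    fix e :: "nat \<Rightarrow> real"
    assume e: "\<And>n. 0 < e n" "e \<longlonglongrightarrow> 0"
    show "(\<lambda>n. LINT z:{z. e n < norm (x - z)}|lebesgue. ?F z) \<longlonglongrightarrow> integral\<^sup>L lebesgue ?F"
      unfolding set_lebesgue_integral_def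
    proof (rule integral_dominated_convergence)
      show "?F \<in> borel_measurable lebesgue"
        using F by simp
      have "open {z. e n < norm (x - z)}" for n
        by (intro open_Collect_less continuous_intros)
      then have "{z. e n < norm (x - z)} \<in> sets lebesgue" for n
        by (intro sets_completionI_sets) simp
      then show "(\<lambda>z. indicat_real {z. e n < norm (x - z)} z *\<^sub>R ?F z) \<in> borel_measurable lebesgue" for n
        using borel_measurable_integrable[OF F] by (intro borel_measurable_scaleR borel_measurable_indicator)
      show "integrable lebesgue (\<lambda>z. norm (?F z))"
        using F by (rule integrable_norm)
      show "AE z in lebesgue. (\<lambda>n. indicat_real {z. e n < norm (x - z)} z *\<^sub>R ?F z) \<longlonglongrightarrow> ?F z"
      proof (rule AE_I2)
        fix z
        show "(\<lambda>n. indicat_real {z. e n < norm (x - z)} z *\<^sub>R ?F z) \<longlonglongrightarrow> ?F z"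
        proof (cases "z = x")
          case False
          then have "\<forall>\<^sub>F n in sequentially. e n < norm (x - z)"
            by (intro order_tendstoD(2)[OF e(2)]) simp
          then have "\<forall>\<^sub>F n in sequentially. indicat_real {z. e n < norm (x - z)} z *\<^sub>R ?F z = ?F z"
            by eventually_elim simp
          then show ?thesis
            by (rule tendsto_eventually)
        qed (simp add: frac_laplacian_integrand_def)
      qed
      show "AE z in lebesgue. norm (indicat_real {z. e n < norm (x - z)} z *\<^sub>R ?F z) \<le> norm (?F z)" for n
        by (intro AE_I2) (simp add: indicator_def)
    qed
  qed simp
  then show ?thesis
    unfolding frac_laplacian_def frac_laplacian_integrand_def[symmetric] by (simp add: tendsto_Lim)
qed

section \<open>Folding along the inversion\<close>

text \<open>
  The name refers to the conjugate point: for \<open>x \<noteq> 0\<close> this is \<open>norm x\<close> times the distance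
  from \<open>y\<close> to \<open>inversion x\<close>, and, for \<open>y \<noteq> 0\<close>, also \<open>norm y\<close> times the
  distance from \<open>x\<close> to \<open>inversion y\<close>.
\<close>

abbreviation conj_dist :: "'a::real_normed_vector \<Rightarrow> 'a \<Rightarrow> real" where
  "conj_dist x y \<equiv> norm (x /\<^sub>R norm x - norm x *\<^sub>R y)"

text \<open>
  The difference of the squares of the two sides is
  \<open>((norm x)\<^sup>2 - 1) * ((norm y)\<^sup>2 - 1)\<close>: points on the same side of the unit sphere are closer
  to each other than to each other's reflections. This makes the reflected kernel nonnegative.
\<close>

lemma norm_diff_le_conj_dist:
  fixes x y :: "'a::real_inner"
  assumes "x \<noteq> 0" "0 \<le> ((norm x)\<^sup>2 - 1) * ((norm y)\<^sup>2 - 1)"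
  shows "norm (x - y) \<le> conj_dist x y"
proof -
  have "(norm (x - y))\<^sup>2 = (norm x)\<^sup>2 - 2 * (x \<bullet> y) + (norm y)\<^sup>2"
    using norm_scaleR_diff_squared[of 1 x 1 y] by simp
  moreover have "(conj_dist x y)\<^sup>2 = 1 - 2 * (x \<bullet> y) + (norm x)\<^sup>2 * (norm y)\<^sup>2"
    using assms(1) unfolding norm_scaleR_diff_squared by (simp add: field_simps)
  ultimately have "(conj_dist x y)\<^sup>2 - (norm (x - y))\<^sup>2 = ((norm x)\<^sup>2 - 1) * ((norm y)\<^sup>2 - 1)"
    by (simp add: algebra_simps)
  with assms(2) have "(norm (x - y))\<^sup>2 \<le> (conj_dist x y)\<^sup>2"
    by linarith
  then show ?thesis
    by (rule power2_le_imp_le) simp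
qed

lemma refl_kernel_nonneg:
  fixes x y :: "real ^ 'n::finite"
  assumes "0 < \<alpha>" "x \<noteq> 0" "y \<noteq> x" "0 \<le> ((norm x)\<^sup>2 - 1) * ((norm y)\<^sup>2 - 1)"
  shows "0 \<le> refl_kernel \<alpha> x y"
proof -
  have "0 < norm (x - y)" using assms(3) by simp
  moreover have "norm (x - y) powr (real CARD('n) + \<alpha>) \<le> conj_dist x y powr (real CARD('n) + \<alpha>)"
    using norm_diff_le_conj_dist[OF assms(2,4)] assms(1) by (intro powr_mono2) simp_all
  ultimately show ?thesis
    by (simp add: refl_kernel_def frac_le)
qed

text \<open>
  The coefficient of \<open>w x\<close> that is left over when the two halves of space are folded onto each other.
\<close>

definition zero_order_density :: "real \<Rightarrow> real ^ 'n \<Rightarrow> real ^ 'n \<Rightarrow> real" where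
  "zero_order_density \<alpha> x y = (1 + norm y powr (\<alpha> - real CARD('n))) / conj_dist x y powr (real CARD('n) + \<alpha>)"

lemma borel_measurable_conj_dist_powr:
  "(\<lambda>y :: 'a::euclidean_space. conj_dist x y powr p) \<in> borel_measurable lebesgue"
proof -
  have "(\<lambda>y :: 'a. conj_dist x y) \<in> borel_measurable borel"
    by (intro borel_measurable_continuous_onI continuous_intros)
  then have "(\<lambda>y :: 'a. conj_dist x y powr p) \<in> borel_measurable borel"
    by (intro powr_real_measurable) simp_all
  then show ?thesis
    by (intro measurable_completion) simp
qed

lemma borel_measurable_refl_kernel: "refl_kernel \<alpha> x \<in> borel_measurable lebesgue"
proof -
  have "(\<lambda>y. norm (x - y) powr (real CARD('n) + \<alpha>)) \<in> borel_measurable borel" for x :: "real ^ 'n"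
    by measurable
  then have "(\<lambda>y. norm (x - y) powr (real CARD('n) + \<alpha>)) \<in> borel_measurable lebesgue" for x :: "real ^ 'n"
    by (intro measurable_completion) simp
  then show ?thesis
    unfolding refl_kernel_def[abs_def]
    by (intro borel_measurable_diff borel_measurable_divide borel_measurable_conj_dist_powr) simp_all
qed

lemma borel_measurable_zero_order_density: "zero_order_density \<alpha> x \<in> borel_measurable lebesgue"
proof -
  have "(\<lambda>y :: real ^ 'n. norm y powr (\<alpha> - real CARD('n))) \<in> borel_measurable borel"
    by measurable
  then have "(\<lambda>y :: real ^ 'n. norm y powr (\<alpha> - real CARD('n))) \<in> borel_measurable lebesgue"
    by (intro measurable_completion) simp
  then show ?thesis
    unfolding zero_order_density_def[abs_def]
    by (intro borel_measurable_add borel_measurable_divide borel_measurable_conj_dist_powr) simp_all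
qed

text \<open>
  The second summand on the left is the integrand at the reflected point times the Jacobian of the inversion.
  The antisymmetry of \<open>w\<close> has precisely the homogeneity for which the powers of \<open>norm y\<close> in
  front of \<open>w y\<close> cancel; those in front of \<open>w x\<close> do not and produce the zero-order term.
\<close>

lemma folded_integrand:
  fixes w :: "real ^ 'n::finite \<Rightarrow> real"
  assumes "x \<noteq> 0" "y \<noteq> 0" and w: "w (inversion y) = - (norm y powr (real CARD('n) - \<alpha>)) * w y"
  shows "frac_laplacian_integrand \<alpha> w x y + frac_laplacian_integrand \<alpha> w x (inversion y) / norm y ^ (2 * CARD('n))
    = (w x - w y) * refl_kernel \<alpha> x y + w x * zero_order_density \<alpha> x y"
proof -
  let ?n = "real CARD('n)" and ?K = "conj_dist x y powr (real CARD('n) + \<alpha>)"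
  have y: "0 < norm y" using assms by simp
  have p: "norm y powr a * norm y powr b = norm y powr (a + b)" for a b
    by (simp add: powr_add)
  have "frac_laplacian_integrand \<alpha> w x (inversion y) / norm y ^ (2 * CARD('n))
      = (w x + norm y powr (?n - \<alpha>) * w y) * (norm y powr (?n + \<alpha>) / norm y powr (2 * ?n)) / ?K"
    using y powr_realpow[OF y, of "2 * CARD('n)"]
    unfolding frac_laplacian_integrand_def w norm_diff_inversion[OF assms(1,2)] by (simp add: powr_divide)
  also have "norm y powr (?n + \<alpha>) / norm y powr (2 * ?n) = norm y powr (\<alpha> - ?n)"
    by (simp add: powr_diff[symmetric])
  also have "(w x + norm y powr (?n - \<alpha>) * w y) * norm y powr (\<alpha> - ?n)
      = w x * norm y powr (\<alpha> - ?n) + w y * (norm y powr (?n - \<alpha>) * norm y powr (\<alpha> - ?n))"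
    by (simp add: algebra_simps)
  also have "norm y powr (?n - \<alpha>) * norm y powr (\<alpha> - ?n) = 1"
    using y by (simp add: p)
  finally show ?thesis
    by (simp add: frac_laplacian_integrand_def refl_kernel_def zero_order_density_def diff_divide_distrib add_divide_distrib algebra_simps)
qed

text \<open>
  Summands of the same sign cannot cancel, so each of them inherits integrability from the sum.
\<close>

lemma set_integrable_nonpos_summand:
  fixes f g :: "'a \<Rightarrow> real"
  assumes "set_integrable M S (\<lambda>y. f y + g y)" "S \<in> sets M" "f \<in> borel_measurable M"
    and "\<And>y. y \<in> S \<Longrightarrow> f y \<le> 0" "\<And>y. y \<in> S \<Longrightarrow> g y \<le> 0"
  shows "set_integrable M S f"
proof (rule set_integrable_bound[OF assms(1)])
  show "set_borel_measurable M S f"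
    unfolding set_borel_measurable_def using assms by (intro borel_measurable_scaleR borel_measurable_indicator)
  show "AE y in M. y \<in> S \<longrightarrow> norm (f y) \<le> norm (f y + g y)"
  proof (intro AE_I2 impI)
    fix y assume "y \<in> S"
    from assms(4,5)[OF this] show "norm (f y) \<le> norm (f y + g y)" by simp
  qed
qed

text \<open>
  The situation common to the exterior and the interior estimate: \<open>S\<close> is one side of the unit sphere,
  its reflection is the other side up to a null set, and \<open>w\<close> has a nonpositive minimum over
  \<open>S\<close> at \<open>x\<close>.
\<close>

locale folded_minimum =
  fixes \<alpha> :: real and w :: "real ^ 'n::finite \<Rightarrow> real" and x :: "real ^ 'n" and S :: "(real ^ 'n) set"
  assumes \<alpha>: "0 < \<alpha>"
    and S: "S \<in> sets lebesgue" "inversion ` S \<in> sets lebesgue" "0 \<notin> S" "S \<inter> inversion ` S = {}"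
      "negligible (- (S \<union> inversion ` S))"
    and same_side: "\<And>y. y \<in> S \<Longrightarrow> 0 \<le> ((norm x)\<^sup>2 - 1) * ((norm y)\<^sup>2 - 1)"
    and x: "x \<in> S"
    and w_measurable: "w \<in> borel_measurable lebesgue"
    and antisymmetric: "\<And>y. y \<in> S \<Longrightarrow> w (inversion y) = - (norm y powr (real CARD('n) - \<alpha>)) * w y"
    and w_nonpos: "w x \<le> 0"
    and minimum: "\<And>y. y \<in> S \<Longrightarrow> w x \<le> w y"
    and integrable: "integrable lebesgue (frac_laplacian_integrand \<alpha> w x)"
begin

lemma x_nonzero: "x \<noteq> 0"
  using x S(3) by auto

text \<open>
  The integral over the reflection of \<open>S\<close> is transported to \<open>S\<close> by the inversion and added to the
  integral over \<open>S\<close>.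
\<close>

lemma
  shows set_integrable_folded:
      "set_integrable lebesgue S (\<lambda>y. (w x - w y) * refl_kernel \<alpha> x y + w x * zero_order_density \<alpha> x y)"
    and integral_folded:
      "integral\<^sup>L lebesgue (frac_laplacian_integrand \<alpha> w x)
        = (LINT y:S|lebesgue. (w x - w y) * refl_kernel \<alpha> x y + w x * zero_order_density \<alpha> x y)"
proof -
  let ?g = "\<lambda>y. frac_laplacian_integrand \<alpha> w x (inversion y) / norm y ^ (2 * CARD('n))"
  let ?h = "\<lambda>y. (w x - w y) * refl_kernel \<alpha> x y + w x * zero_order_density \<alpha> x y"
  have FS: "set_integrable lebesgue A (frac_laplacian_integrand \<alpha> w x)" if "A \<in> sets lebesgue" for A
    using integrable_mult_indicator[OF that integrable] by (simp add: set_integrable_def)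
  note inv = set_integrable_inversion[OF S(1,3) FS[OF S(2)]]
    set_lebesgue_integral_inversion[OF S(1,3) FS[OF S(2)]]
  have eq: "frac_laplacian_integrand \<alpha> w x y + ?g y = ?h y" if "y \<in> S" for y
    using folded_integrand[OF x_nonzero _ antisymmetric[OF that]] S(3) that by metis
  have "set_integrable lebesgue S (\<lambda>y. frac_laplacian_integrand \<alpha> w x y + ?g y)"
    by (rule set_integral_add(1)[OF FS[OF S(1)] inv(1)])
  then show "set_integrable lebesgue S ?h"
    by (subst set_integrable_cong[OF refl refl, symmetric, OF eq])
  have "AE z in lebesgue. z \<in> S \<union> inversion ` S"
    using S(5) by (intro AE_I'[of "- (S \<union> inversion ` S)"]) (auto simp: negligible_iff_null_sets)
  then have "AE z in lebesgue. frac_laplacian_integrand \<alpha> w x z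
      = indicator (S \<union> inversion ` S) z *\<^sub>R frac_laplacian_integrand \<alpha> w x z"
    by eventually_elim (simp add: indicator_def)
  moreover have "(\<lambda>z. indicator (S \<union> inversion ` S) z *\<^sub>R frac_laplacian_integrand \<alpha> w x z) \<in> borel_measurable lebesgue"
    by (intro borel_measurable_scaleR borel_measurable_indicator borel_measurable_integrable[OF integrable] sets.Un S(1,2))
  ultimately have "integral\<^sup>L lebesgue (frac_laplacian_integrand \<alpha> w x)
      = (LINT z:S \<union> inversion ` S|lebesgue. frac_laplacian_integrand \<alpha> w x z)"
    unfolding set_lebesgue_integral_def by (intro integral_cong_AE borel_measurable_integrable[OF integrable])
  also have "\<dots> = (LINT z:S|lebesgue. frac_laplacian_integrand \<alpha> w x z) + (LINT z:inversion ` S|lebesgue. frac_laplacian_integrand \<alpha> w x z)"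
    by (rule set_integral_Un[OF S(4) FS[OF S(1)] FS[OF S(2)]])
  also have "\<dots> = (LINT y:S|lebesgue. frac_laplacian_integrand \<alpha> w x y + ?g y)"
    unfolding inv(2) by (rule set_integral_add(2)[OF FS[OF S(1)] inv(1), symmetric])
  also have "\<dots> = (LINT y:S|lebesgue. ?h y)"
    using eq by (intro set_lebesgue_integral_cong[OF S(1)]) blast
  finally show "integral\<^sup>L lebesgue (frac_laplacian_integrand \<alpha> w x) = (LINT y:S|lebesgue. ?h y)" .
qed

text \<open>
  In the last estimate the nonnegative density is replaced by its lower bound \<open>1 / R powr (n + \<alpha>)\<close> on a test
  ball inside \<open>S\<close>. The factor \<open>w x\<close> is nonpositive, so this bounds the zero-order term from above.
\<close>

lemma
  shows set_integrable_refl_kernel: "set_integrable lebesgue S (\<lambda>y. (w x - w y) * refl_kernel \<alpha> x y)"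
    and integral_refl_kernel_nonpos: "(LINT y:S|lebesgue. (w x - w y) * refl_kernel \<alpha> x y) \<le> 0"
    and integral_le_refl_kernel:
      "\<lbrakk>ball a \<rho> \<subseteq> S; 0 < \<rho>; \<And>y. y \<in> ball a \<rho> \<Longrightarrow> conj_dist x y \<le> R\<rbrakk> \<Longrightarrow>
        integral\<^sup>L lebesgue (frac_laplacian_integrand \<alpha> w x) \<le> (LINT y:S|lebesgue. (w x - w y) * refl_kernel \<alpha> x y)
          + w x * (measure lborel (ball (0 :: real ^ 'n) 1) * \<rho> ^ CARD('n) / R powr (real CARD('n) + \<alpha>))"
proof -
  let ?k = "\<lambda>y. (w x - w y) * refl_kernel \<alpha> x y" and ?z = "\<lambda>y. w x * zero_order_density \<alpha> x y"
  let ?N = "real CARD('n) + \<alpha>"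
  have k: "?k y \<le> 0" if "y \<in> S" for y
    using refl_kernel_nonneg[OF \<alpha> x_nonzero _ same_side[OF that]] minimum[OF that]
    by (cases "y = x") (simp_all add: mult_nonpos_nonneg)
  have z: "?z y \<le> 0" for y
    using w_nonpos by (intro mult_nonpos_nonneg) (simp_all add: zero_order_density_def)
  have km: "?k \<in> borel_measurable lebesgue"
    using w_measurable by (intro borel_measurable_times borel_measurable_diff borel_measurable_refl_kernel) simp_all
  have zm: "?z \<in> borel_measurable lebesgue"
    by (intro borel_measurable_times borel_measurable_zero_order_density) simp_all
  show ki: "set_integrable lebesgue S ?k"
    using set_integrable_nonpos_summand[OF set_integrable_folded S(1) km k z] .
  have "(LINT y:S|lebesgue. ?k y) \<le> (LINT y:S|lebesgue. 0)"
    by (rule set_integral_mono[OF ki]) (simp_all add: k set_integrable_def)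
  then show "(LINT y:S|lebesgue. ?k y) \<le> 0"
    by (simp add: set_lebesgue_integral_def)
  have "set_integrable lebesgue S (\<lambda>y. ?z y + ?k y)"
    using set_integrable_folded by (simp add: add.commute)
  then have zi: "set_integrable lebesgue S ?z"
    by (rule set_integrable_nonpos_summand[OF _ S(1) zm z]) (rule k)
  assume B: "ball a \<rho> \<subseteq> S" "0 < \<rho>" and R: "\<And>y. y \<in> ball a \<rho> \<Longrightarrow> conj_dist x y \<le> R"
  let ?m = "w x / R powr ?N"
  have pos: "0 < conj_dist x y" if "y \<in> S" for y
  proof -
    have "x \<noteq> inversion y" "y \<noteq> 0" using that x S(3,4) by auto
    then show ?thesis
      using norm_diff_inversion[OF x_nonzero \<open>y \<noteq> 0\<close>] by (metis divide_eq_0_iff norm_eq_zero right_minus_eq zero_less_norm_iff)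
  qed
  have vol: "measure lebesgue (ball a \<rho>) = measure lborel (ball (0 :: real ^ 'n) 1) * \<rho> ^ CARD('n)"
    using content_ball_conv_unit_ball[of \<rho> a] B(2) by (simp add: mult.commute)
  have split: "integral\<^sup>L lebesgue (frac_laplacian_integrand \<alpha> w x)
      = (LINT y:S|lebesgue. ?k y) + (LINT y:S|lebesgue. ?z y)"
    by (rule trans[OF integral_folded set_integral_add(2)[OF ki zi]])
  have "(LINT y:S|lebesgue. ?z y) \<le> (LINT y:S|lebesgue. indicator (ball a \<rho>) y * ?m)"
  proof (rule set_integral_mono[OF zi])
    have "set_integrable lebesgue (ball a \<rho>) (\<lambda>y. ?m)"
      by (intro absolutely_integrable_on_const) simp
    then show "set_integrable lebesgue S (\<lambda>y. indicator (ball a \<rho>) y * ?m)"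
      unfolding set_integrable_def using B(1)
      by (rule_tac Bochner_Integration.integrable_cong[OF refl, THEN iffD1]) (auto simp: indicator_def)
    fix y assume y: "y \<in> S"
    show "?z y \<le> indicator (ball a \<rho>) y * ?m"
    proof (cases "y \<in> ball a \<rho>")
      case True
      have "1 / R powr ?N \<le> 1 / conj_dist x y powr ?N"
        using R[OF True] pos[OF y] less_le_trans[OF pos[OF y] R[OF True]] \<alpha> by (intro divide_left_mono powr_mono2 mult_pos_pos) simp_all
      also have "\<dots> \<le> zero_order_density \<alpha> x y"
        unfolding zero_order_density_def by (intro divide_right_mono) simp_all
      finally have "w x * zero_order_density \<alpha> x y \<le> w x * (1 / R powr ?N)"
        using w_nonpos by (intro mult_left_mono_neg)
      with True show ?thesis by simp
    qed (use z[of y] in simp)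
  qed
  also have "\<dots> = (LINT y:ball a \<rho>|lebesgue. ?m)"
    unfolding set_lebesgue_integral_def using B(1) by (intro Bochner_Integration.integral_cong) (auto simp: indicator_def)
  also have "\<dots> = w x * (measure lborel (ball (0 :: real ^ 'n) 1) * \<rho> ^ CARD('n) / R powr ?N)"
  proof -
    have "emeasure lebesgue (ball a \<rho>) \<noteq> \<infinity>"
      using emeasure_lborel_ball_finite[of a \<rho>] by simp
    then show ?thesis
      by (subst set_integral_const) (simp_all add: vol)
  qed
  finally have "(LINT y:S|lebesgue. ?z y) \<le> w x * (measure lborel (ball (0 :: real ^ 'n) 1) * \<rho> ^ CARD('n) / R powr ?N)" .
  with split show "integral\<^sup>L lebesgue (frac_laplacian_integrand \<alpha> w x) \<le> (LINT y:S|lebesgue. ?k y)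
      + w x * (measure lborel (ball (0 :: real ^ 'n) 1) * \<rho> ^ CARD('n) / R powr ?N)"
    by linarith
qed

end

text \<open>
  The integrand \<open>w y * k y\<close> need not be integrable, but its positive part is: off \<open>x\<close> it is
  dominated by \<open>(w y - b) * k y\<close>. If the integral of the negative part is infinite, the right-hand side is
  \<open>\<infinity>\<close>; otherwise both integrals are finite and dropping \<open>b * k y \<le> 0\<close> gives the claim.
  The point \<open>x\<close> is excluded because at its pole the reflected kernel is negative, the singular term
  having the default value \<open>1 / 0 = 0\<close> there.
\<close>

lemma set_integral_le_minus_ereal_set_integral:
  fixes w k :: "'a::euclidean_space \<Rightarrow> real"
  assumes S: "S \<in> sets lebesgue" and m: "w \<in> borel_measurable lebesgue" "k \<in> borel_measurable lebesgue"
    and i: "set_integrable lebesgue S (\<lambda>y. (b - w y) * k y)" and b: "b \<le> 0"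
    and w: "\<And>y. y \<in> S \<Longrightarrow> b \<le> w y" and k: "\<And>y. y \<in> S \<Longrightarrow> y \<noteq> x \<Longrightarrow> 0 \<le> k y"
  shows "ereal (LINT y:S|lebesgue. (b - w y) * k y) \<le> - ereal_set_integral S (\<lambda>y. w y * k y)"
proof -
  have AE: "AE y in lebesgue. y \<noteq> x"
    by (intro AE_completion AE_lborel_singleton)
  define f where "f y = indicator S y *\<^sub>R (w y * k y)" for y
  define g where "g y = indicator S y *\<^sub>R ((b - w y) * k y)" for y
  have f: "f \<in> borel_measurable lebesgue"
    unfolding f_def using S m by (intro borel_measurable_scaleR borel_measurable_indicator borel_measurable_times)
  have g: "integrable lebesgue g"
    using i by (simp add: g_def[abs_def] set_integrable_def)
  have fg: "g y \<le> - f y \<and> g y \<le> 0" if "y \<noteq> x" for y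
  proof (cases "y \<in> S")
    case True
    then have "b * k y \<le> 0" "(b - w y) * k y \<le> 0"
      using b w[OF True] k[OF True that] by (simp_all add: mult_nonpos_nonneg)
    with True show ?thesis by (simp add: f_def g_def algebra_simps)
  qed (simp add: f_def g_def)
  have P: "(\<integral>\<^sup>+y\<in>S. ennreal (w y * k y) \<partial>lebesgue) = (\<integral>\<^sup>+y. ennreal (f y) \<partial>lebesgue)"
    by (intro nn_integral_cong) (simp add: f_def indicator_def)
  have Q: "(\<integral>\<^sup>+y\<in>S. ennreal (- (w y * k y)) \<partial>lebesgue) = (\<integral>\<^sup>+y. ennreal (- f y) \<partial>lebesgue)"
    by (intro nn_integral_cong) (simp add: f_def indicator_def)
  have "(\<integral>\<^sup>+y. ennreal (f y) \<partial>lebesgue) \<le> (\<integral>\<^sup>+y. ennreal (norm (g y)) \<partial>lebesgue)"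
    using AE by (intro nn_integral_mono_AE) (auto elim!: eventually_mono dest!: fg intro!: ennreal_leI)
  also have "\<dots> < \<infinity>"
    using g by (simp add: integrable_iff_bounded)
  finally have fin: "(\<integral>\<^sup>+y. ennreal (f y) \<partial>lebesgue) < \<infinity>" .
  show ?thesis
  proof (cases "(\<integral>\<^sup>+y. ennreal (- f y) \<partial>lebesgue) = \<infinity>")
    case True
    then show ?thesis
      using fin unfolding ereal_set_integral_def P Q by (cases "\<integral>\<^sup>+y. ennreal (f y) \<partial>lebesgue") simp_all
  next
    case False
    then have fi: "integrable lebesgue f"
      using f fin by (simp add: real_integrable_def less_top)
    then have "set_integrable lebesgue S (\<lambda>y. w y * k y)"
      by (simp add: f_def[abs_def] set_integrable_def)
    from ereal_set_integral_eq_lebesgue[OF this]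
    have "ereal_set_integral S (\<lambda>y. w y * k y) = ereal (integral\<^sup>L lebesgue f)"
      by (simp add: set_lebesgue_integral_def f_def[abs_def])
    moreover have "integral\<^sup>L lebesgue g \<le> integral\<^sup>L lebesgue (\<lambda>y. - f y)"
      using AE fi g by (intro integral_mono_AE) (auto elim!: eventually_mono dest!: fg)
    ultimately show ?thesis
      by (simp add: set_lebesgue_integral_def g_def[abs_def])
  qed
qed

section \<open>Test balls at the unit sphere\<close>

lemma sphere_dist_eq:
  fixes x :: "'a::real_normed_vector"
  assumes "x \<noteq> 0"
  shows "sphere_dist x = \<bar>norm x - 1\<bar>"
proof -
  let ?u = "x /\<^sub>R norm x"
  have u: "?u \<in> sphere 0 1"
    using assms by simp
  have "x - ?u = (1 - inverse (norm x)) *\<^sub>R x"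
    by (simp add: algebra_simps)
  then have "norm (x - ?u) = \<bar>1 - inverse (norm x)\<bar> * \<bar>norm x\<bar>"
    by simp
  also have "\<dots> = \<bar>norm x - 1\<bar>"
  proof -
    have "(1 - inverse (norm x)) * norm x = norm x - 1"
      using assms by (simp add: left_diff_distrib)
    then show ?thesis
      by (simp only: abs_mult[symmetric])
  qed
  finally have "dist x ?u = \<bar>norm x - 1\<bar>"
    by (simp add: dist_norm)
  then have "infdist x (sphere 0 1) \<le> \<bar>norm x - 1\<bar>"
    using infdist_le[OF u, of x] by simp
  moreover have "\<bar>norm x - 1\<bar> \<le> infdist x (sphere 0 1)"
  proof -
    have "\<bar>norm x - 1\<bar> \<le> dist x y" if "y \<in> sphere 0 1" for y
      using that norm_triangle_ineq3[of x y] by (simp add: dist_norm)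
    moreover have "sphere (0::'a) 1 \<noteq> {}"
      using u by blast
    ultimately show ?thesis
      unfolding infdist_def by (auto intro!: cINF_greatest)
  qed
  ultimately show ?thesis
    by (simp add: sphere_dist_def frontier_ball)
qed

lemma negligible_off_sphere_pieces:
  "negligible (- ({y :: 'a::euclidean_space. 1 < norm y} \<union> (ball 0 1 - {0})))"
proof (rule negligible_subset)
  show "negligible (sphere (0::'a) 1 \<union> {0})"
    by (intro negligible_Un negligible_sphere) simp
qed auto

lemma open_exterior: "open {y :: 'a::real_normed_vector. 1 < norm y}"
  by (intro open_Collect_less continuous_intros)

text \<open>
  The folding needs the origin removed, since its reflection would lie at infinity.
\<close>

lemma
  fixes f :: "'a::euclidean_space \<Rightarrow> real"
  assumes f: "set_integrable lebesgue (ball 0 1 - {0}) f"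
  shows set_integrable_unpuncture: "set_integrable lebesgue {y. norm y < 1} f"
    and set_lebesgue_integral_unpuncture:
      "(LINT y:{y. norm y < 1}|lebesgue. f y) = (LINT y:ball 0 1 - {0}|lebesgue. f y)"
proof -
  have B: "{y :: 'a. norm y < 1} = ball 0 1"
    by (auto simp: dist_norm)
  have N: "negligible {y \<in> ball 0 1 - {0} - ball 0 1. f y \<noteq> 0}" "negligible {y \<in> ball 0 1 - (ball 0 1 - {0}). f y \<noteq> 0}"
    by (auto intro: negligible_subset[of "{0}"])
  show i: "set_integrable lebesgue {y. norm y < 1} f"
    unfolding B by (rule absolutely_integrable_spike_set[OF f N])
  show "(LINT y:{y. norm y < 1}|lebesgue. f y) = (LINT y:ball 0 1 - {0}|lebesgue. f y)"
    unfolding set_lebesgue_integral_eq_integral(2)[OF i] set_lebesgue_integral_eq_integral(2)[OF f]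
    unfolding B by (rule integral_spike_set) (use N in simp_all)
qed

lemma spherically_antisymmetric_exterior:
  fixes w :: "real ^ 'n::finite \<Rightarrow> real"
  assumes "spherically_antisymmetric \<alpha> w" "1 \<le> norm y"
  shows "w (inversion y) = - (norm y powr (real CARD('n) - \<alpha>)) * w y"
proof -
  have "0 < norm y powr (real CARD('n) - \<alpha>)"
    using assms(2) by auto
  moreover have "w y = - (1 / norm y powr (real CARD('n) - \<alpha>)) * w (inversion y)"
    using assms unfolding spherically_antisymmetric_def inversion_def by blast
  ultimately show ?thesis
    by (simp add: field_simps)
qed

text \<open>
  The antisymmetry relation is invariant under inversion: its instance at the exterior point \<open>inversion y\<close>,
  solved for the value there, has the same form as the exterior relation.
\<close>

lemma spherically_antisymmetric_interior:
  fixes w :: "real ^ 'n::finite \<Rightarrow> real"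
  assumes "spherically_antisymmetric \<alpha> w" "y \<noteq> 0" "norm y \<le> 1"
  shows "w (inversion y) = - (norm y powr (real CARD('n) - \<alpha>)) * w y"
proof -
  have y: "0 < norm y" "0 < norm y powr (real CARD('n) - \<alpha>)"
    using assms(2) by auto
  have "w (inversion (inversion y)) = - (norm (inversion y) powr (real CARD('n) - \<alpha>)) * w (inversion y)"
    using y assms(3) by (intro spherically_antisymmetric_exterior[OF assms(1)]) simp
  then show ?thesis
    using y by (simp add: powr_divide field_simps)
qed

text \<open>
  With \<open>\<delta> = (norm x - 1) / norm x\<close>, the distance from the reflected point \<open>inversion x\<close> to the
  unit sphere, the test ball of radius \<open>\<delta>\<close> touches the sphere from outside in \<open>x /\<^sub>R norm x\<close>.
  All its points are within \<open>3 * \<delta>\<close> of \<open>inversion x\<close>.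
\<close>

lemma exterior_test_ball:
  fixes x y :: "'a::real_inner"
  assumes x: "1 < norm x" and y: "y \<in> ball ((1 + (norm x - 1) / norm x) *\<^sub>R (x /\<^sub>R norm x)) ((norm x - 1) / norm x)"
  shows "1 < norm y" "conj_dist x y \<le> 3 * (norm x - 1)"
proof -
  define u where "u = x /\<^sub>R norm x"
  define \<delta> where "\<delta> = (norm x - 1) / norm x"
  define a where "a = (1 + \<delta>) *\<^sub>R u"
  have "x \<noteq> 0"
    using x by auto
  then have u: "norm u = 1"
    by (simp add: u_def)
  have \<delta>: "0 < \<delta>" "norm x * \<delta> = norm x - 1" "inverse (norm x) = 1 - \<delta>"
    using x \<open>x \<noteq> 0\<close> by (simp_all add: \<delta>_def diff_divide_distrib inverse_eq_divide right_diff_distrib)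
  have ay: "norm (a - y) < \<delta>"
    using y by (simp add: a_def u_def \<delta>_def dist_norm)
  have "norm a = 1 + \<delta>"
    using \<delta>(1) u by (simp add: a_def)
  then show "1 < norm y"
    using ay norm_triangle_ineq2[of a y] by simp
  have "inverse (norm x) *\<^sub>R u - a = (- 2 * \<delta>) *\<^sub>R u"
    unfolding \<delta>(3) a_def by (simp add: algebra_simps flip: scaleR_2)
  then have "norm (inverse (norm x) *\<^sub>R u - a) = 2 * \<delta>"
    using \<delta>(1) u by simp
  then have "norm (inverse (norm x) *\<^sub>R u - y) \<le> 3 * \<delta>"
    using ay norm_triangle_ineq[of "inverse (norm x) *\<^sub>R u - a" "a - y"] by simp
  then have "norm x * norm (inverse (norm x) *\<^sub>R u - y) \<le> norm x * (3 * \<delta>)"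
    by (intro mult_left_mono) simp_all
  also have "\<dots> = 3 * (norm x - 1)"
    using \<delta>(2) by simp
  also have "norm x * norm (inverse (norm x) *\<^sub>R u - y) = norm (norm x *\<^sub>R (inverse (norm x) *\<^sub>R u - y))"
    by simp
  also have "norm x *\<^sub>R (inverse (norm x) *\<^sub>R u - y) = u - norm x *\<^sub>R y"
  proof -
    have "norm x \<noteq> 0" using x by linarith
    then show ?thesis by (simp add: scaleR_diff_right)
  qed
  finally show "conj_dist x y \<le> 3 * (norm x - 1)"
    by (simp add: u_def)
qed

text \<open>
  The test ball touches the sphere from inside in \<open>x /\<^sub>R norm x\<close>. Its diameter is the distance
  \<open>1 - norm x\<close>, which also keeps it away from the origin.
\<close>

lemma interior_test_ball:
  fixes x y :: "'a::real_inner"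
  assumes x: "0 < norm x" "norm x < 1"
    and y: "y \<in> ball ((1 - (1 - norm x) / 2) *\<^sub>R (x /\<^sub>R norm x)) ((1 - norm x) / 2)"
  shows "y \<noteq> 0" "norm y < 1" "conj_dist x y \<le> 2 * (1 - norm x)"
proof -
  define u where "u = x /\<^sub>R norm x"
  define d where "d = 1 - norm x"
  define a where "a = (1 - d / 2) *\<^sub>R u"
  have u: "norm u = 1"
    using x by (simp add: u_def)
  have d: "0 < d" "d < 1"
    using x by (simp_all add: d_def)
  have ay: "norm (a - y) < d / 2"
    using y by (simp add: a_def u_def d_def dist_norm)
  have a: "norm a = 1 - d / 2"
    using d u by (simp add: a_def)
  show y1: "norm y < 1"
    using ay a norm_triangle_ineq2[of y a] by (simp add: norm_minus_commute)
  show "y \<noteq> 0"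
    using ay a d by auto
  have "u - a = (d / 2) *\<^sub>R u"
    by (simp add: a_def algebra_simps)
  then have "norm (u - a) = d / 2"
    using d u by simp
  then have "norm (u - y) \<le> d"
    using ay norm_triangle_ineq[of "u - a" "a - y"] by simp
  moreover have "norm (y - norm x *\<^sub>R y) \<le> d"
  proof -
    have "y - norm x *\<^sub>R y = d *\<^sub>R y"
      by (simp add: d_def algebra_simps)
    then show ?thesis
      using d y1 by simp
  qed
  moreover have "norm (u - norm x *\<^sub>R y) \<le> norm (u - y) + norm (y - norm x *\<^sub>R y)"
    using norm_triangle_ineq[of "u - y" "y - norm x *\<^sub>R y"] by simp
  ultimately show "conj_dist x y \<le> 2 * (1 - norm x)"
    by (simp add: u_def d_def)
qed

section \<open>The exterior and the interior estimate\<close>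

text \<open>
  Both terms on the right are nonpositive, so a single constant, at most each of their coefficients, may stand in
  front of the sum.
\<close>

lemma scaled_by_min_constant:
  fixes J I A b c :: real
  assumes "J \<le> I + b * A" "I \<le> 0" "A \<le> 0" "0 < c"
  shows "c * J \<le> c * min 1 b * (A + I)"
proof -
  have "I \<le> min 1 b * I" "b * A \<le> min 1 b * A"
    using assms mult_right_mono_neg[of "min 1 b" 1 I] mult_right_mono_neg[of "min 1 b" b A] by simp_all
  with assms(1) have "J \<le> min 1 b * (A + I)"
    by (simp add: algebra_simps)
  then show ?thesis
    using assms(4) mult_left_mono[of J "min 1 b * (A + I)" c] by (simp add: mult.assoc)
qed

proposition frac_laplacian_le_exterior:
  fixes \<alpha> c :: real and w :: "real ^ 'n::finite \<Rightarrow> real"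
  assumes \<alpha>: "0 < \<alpha>" "\<alpha> < 2" and c: "0 < c"
    and w: "w \<in> L_space \<alpha>" "spherically_antisymmetric \<alpha> w" "w x \<le> 0" "C11_loc_at w x"
    and x: "1 < norm x" and inf: "\<And>y. 1 \<le> norm y \<Longrightarrow> w x \<le> w y"
  defines "C \<equiv> c * min 1 (measure lborel (ball (0 :: real ^ 'n) 1) / 3 powr (real CARD('n) + \<alpha>))"
    and "A \<equiv> w x / (sphere_dist x powr \<alpha> * (1 + sphere_dist x) ^ CARD('n))"
  shows "ereal (frac_laplacian c \<alpha> w x)
      \<le> ereal C * (ereal A + ereal_set_integral {y. 1 < norm y} (\<lambda>y. (w x - w y) * refl_kernel \<alpha> x y))"
    and "ereal (frac_laplacian c \<alpha> w x)
      \<le> - ereal C * ereal_set_integral {y. 1 < norm y} (\<lambda>y. w y * refl_kernel \<alpha> x y)"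
proof -
  let ?S = "{y :: real ^ 'n. 1 < norm y}" and ?N = "real CARD('n) + \<alpha>"
  let ?I = "LINT y:?S|lebesgue. (w x - w y) * refl_kernel \<alpha> x y"
  let ?\<omega> = "measure lborel (ball (0 :: real ^ 'n) 1)"
  define d where "d = norm x - 1"
  have x0: "x \<noteq> 0"
    using x by auto
  then have d: "0 < d" "norm x = 1 + d" "sphere_dist x = d"
    using x sphere_dist_eq[of x] by (auto simp: d_def)
  have F: "integrable lebesgue (frac_laplacian_integrand \<alpha> w x)"
    using x inf by (intro integrable_frac_laplacian_integrand[OF \<alpha> w(1,4) open_exterior]) simp_all
  have S: "?S \<in> sets lebesgue" "inversion ` ?S \<in> sets lebesgue" "0 \<notin> ?S" "?S \<inter> inversion ` ?S = {}"
      "negligible (- (?S \<union> inversion ` ?S))"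
    unfolding inversion_exterior using open_exterior negligible_off_sphere_pieces
    by (auto intro!: sets_completionI_sets)
  have sgn: "0 \<le> ((norm x)\<^sup>2 - 1) * ((norm y)\<^sup>2 - 1)" if "y \<in> ?S" for y
    using that x by (intro mult_nonneg_nonneg) (simp_all add: one_le_power)
  have wm: "w \<in> borel_measurable lebesgue"
    using w(1) by (simp add: L_space_def)
  have anti: "w (inversion y) = - (norm y powr (real CARD('n) - \<alpha>)) * w y" if "y \<in> ?S" for y
    using that by (intro spherically_antisymmetric_exterior[OF w(2)]) simp
  have le: "w x \<le> w y" if "y \<in> ?S" for y
    using that inf by simp
  have xS: "x \<in> ?S" using x by simp
  interpret folded: folded_minimum \<alpha> w x ?S
    using \<alpha>(1) S sgn xS wm anti w(3) le F by unfold_locales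
  let ?B = "ball ((1 + d / norm x) *\<^sub>R (x /\<^sub>R norm x)) (d / norm x)"
  have B: "1 < norm y" "conj_dist x y \<le> 3 * d" if "y \<in> ?B" for y
    using exterior_test_ball[OF x that[unfolded d_def]] by (simp_all add: d_def)
  then have sub: "?B \<subseteq> ?S"
    by blast
  have pos: "0 < d / norm x"
    using d(1) x0 by simp
  have "integral\<^sup>L lebesgue (frac_laplacian_integrand \<alpha> w x)
      \<le> ?I + w x * (?\<omega> * (d / norm x) ^ CARD('n) / (3 * d) powr ?N)"
    by (rule folded.integral_le_refl_kernel[OF sub pos B(2)])
  also have "w x * (?\<omega> * (d / norm x) ^ CARD('n) / (3 * d) powr ?N) = ?\<omega> / 3 powr ?N * A"
  proof -
    have "(3 * d) powr ?N = 3 powr ?N * (d ^ CARD('n) * d powr \<alpha>)"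
      using d(1) by (simp add: powr_mult powr_add powr_realpow)
    then show ?thesis
      using d(1) unfolding A_def d(2,3) by (simp add: power_divide field_simps)
  qed
  finally have J: "integral\<^sup>L lebesgue (frac_laplacian_integrand \<alpha> w x) \<le> ?I + ?\<omega> / 3 powr ?N * A" .
  have A0: "A \<le> 0"
    using w(3) d(1) unfolding A_def d(3) by (intro divide_nonpos_nonneg) simp_all
  have "0 < C"
    using c by (simp add: C_def)
  have main: "frac_laplacian c \<alpha> w x \<le> C * (A + ?I)"
    unfolding frac_laplacian_eq_integral[OF F] C_def using scaled_by_min_constant[OF J folded.integral_refl_kernel_nonpos A0 c] .
  then show "ereal (frac_laplacian c \<alpha> w x)
      \<le> ereal C * (ereal A + ereal_set_integral ?S (\<lambda>y. (w x - w y) * refl_kernel \<alpha> x y))"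
    unfolding ereal_set_integral_eq_lebesgue[OF folded.set_integrable_refl_kernel] by simp
  let ?E = "ereal_set_integral ?S (\<lambda>y. w y * refl_kernel \<alpha> x y)"
  have "ereal ?I \<le> - ?E"
    using set_integral_le_minus_ereal_set_integral[OF S(1) wm borel_measurable_refl_kernel folded.set_integrable_refl_kernel w(3) le
        refl_kernel_nonneg[OF \<alpha>(1) x0 _ sgn]] by blast
  then have "ereal C * ereal ?I \<le> ereal C * - ?E"
    using \<open>0 < C\<close> by (intro ereal_mult_left_mono) simp_all
  moreover have "frac_laplacian c \<alpha> w x \<le> C * ?I"
    using main mult_nonneg_nonpos[of C A] A0 \<open>0 < C\<close> by (simp add: algebra_simps)
  ultimately have "ereal (frac_laplacian c \<alpha> w x) \<le> ereal C * - ?E"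
    by (simp add: order_trans[of _ "ereal (C * ?I)"])
  then show "ereal (frac_laplacian c \<alpha> w x) \<le> - ereal C * ?E"
    by (simp only: ereal_mult_minus_left ereal_mult_minus_right)
qed

proposition frac_laplacian_le_interior:
  fixes \<alpha> c :: real and w :: "real ^ 'n::finite \<Rightarrow> real"
  assumes \<alpha>: "0 < \<alpha>" "\<alpha> < 2" and c: "0 < c"
    and w: "w \<in> L_space \<alpha>" "spherically_antisymmetric \<alpha> w" "w x \<le> 0" "C11_loc_at w x"
    and x: "0 < norm x" "norm x < 1" and inf: "\<And>y. \<lbrakk>0 < norm y; norm y < 1\<rbrakk> \<Longrightarrow> w x \<le> w y"
  defines "C \<equiv> c * min 1 (measure lborel (ball (0 :: real ^ 'n) 1) / 2 ^ CARD('n) / 2 powr (real CARD('n) + \<alpha>))"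
  shows "ereal (frac_laplacian c \<alpha> w x)
      \<le> ereal C * (ereal (w x / sphere_dist x powr \<alpha>)
          + ereal_set_integral {y. norm y < 1} (\<lambda>y. (w x - w y) * refl_kernel \<alpha> x y))"
proof -
  let ?S = "ball 0 1 - {0} :: (real ^ 'n) set" and ?N = "real CARD('n) + \<alpha>"
  let ?I = "LINT y:?S|lebesgue. (w x - w y) * refl_kernel \<alpha> x y"
  let ?\<omega> = "measure lborel (ball (0 :: real ^ 'n) 1)"
  define d where "d = 1 - norm x"
  define A where "A = w x / sphere_dist x powr \<alpha>"
  have d: "0 < d" "sphere_dist x = d" and x0: "x \<noteq> 0"
    using x sphere_dist_eq[of x] by (auto simp: d_def)
  have xS: "x \<in> ?S" using x by simp
  have op: "open ?S" by auto
  have F: "integrable lebesgue (frac_laplacian_integrand \<alpha> w x)"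
    using inf by (intro integrable_frac_laplacian_integrand[OF \<alpha> w(1,4) op xS]) simp
  have S: "?S \<in> sets lebesgue" "inversion ` ?S \<in> sets lebesgue" "0 \<notin> ?S" "?S \<inter> inversion ` ?S = {}"
      "negligible (- (?S \<union> inversion ` ?S))"
    unfolding inversion_punctured_ball using open_exterior op negligible_off_sphere_pieces
    by (auto intro!: sets_completionI_sets simp: Un_commute)
  have sgn: "0 \<le> ((norm x)\<^sup>2 - 1) * ((norm y)\<^sup>2 - 1)" if "y \<in> ?S" for y
    using that x by (intro mult_nonpos_nonpos) (simp_all add: power_le_one)
  have wm: "w \<in> borel_measurable lebesgue"
    using w(1) by (simp add: L_space_def)
  have anti: "w (inversion y) = - (norm y powr (real CARD('n) - \<alpha>)) * w y" if "y \<in> ?S" for y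
    using that by (intro spherically_antisymmetric_interior[OF w(2)]) simp_all
  have le: "w x \<le> w y" if "y \<in> ?S" for y
    using that inf by simp
  interpret folded: folded_minimum \<alpha> w x ?S
    using \<alpha>(1) S sgn xS wm anti w(3) le F by unfold_locales
  let ?B = "ball ((1 - d / 2) *\<^sub>R (x /\<^sub>R norm x)) (d / 2)"
  have B: "y \<in> ?S" "conj_dist x y \<le> 2 * d" if "y \<in> ?B" for y
    using interior_test_ball[OF x that[unfolded d_def]] by (simp_all add: d_def)
  then have sub: "?B \<subseteq> ?S"
    by blast
  have pos: "0 < d / 2"
    using d(1) by simp
  have "integral\<^sup>L lebesgue (frac_laplacian_integrand \<alpha> w x)
      \<le> ?I + w x * (?\<omega> * (d / 2) ^ CARD('n) / (2 * d) powr ?N)"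
    by (rule folded.integral_le_refl_kernel[OF sub pos B(2)])
  also have "w x * (?\<omega> * (d / 2) ^ CARD('n) / (2 * d) powr ?N) = ?\<omega> / 2 ^ CARD('n) / 2 powr ?N * A"
  proof -
    have "(2 * d) powr ?N = 2 powr ?N * (d ^ CARD('n) * d powr \<alpha>)"
      using d(1) by (simp add: powr_mult powr_add powr_realpow)
    then show ?thesis
      using d(1) unfolding A_def d(2) by (simp add: power_divide field_simps)
  qed
  finally have J: "integral\<^sup>L lebesgue (frac_laplacian_integrand \<alpha> w x)
    \<le> ?I + ?\<omega> / 2 ^ CARD('n) / 2 powr ?N * A" .
  have A0: "A \<le> 0"
    using w(3) unfolding A_def by (intro divide_nonpos_nonneg) simp_all
  have "frac_laplacian c \<alpha> w x \<le> C * (A + ?I)"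
    unfolding frac_laplacian_eq_integral[OF F] C_def using scaled_by_min_constant[OF J folded.integral_refl_kernel_nonpos A0 c] .
  then show ?thesis
    unfolding ereal_set_integral_eq_lebesgue[OF set_integrable_unpuncture[OF folded.set_integrable_refl_kernel]]
      set_lebesgue_integral_unpuncture[OF folded.set_integrable_refl_kernel] A_def by simp
qed

theorem theorem1p1:
  fixes \<alpha> c :: real
  assumes "0 < \<alpha>" and "\<alpha> < 2" and "\<alpha> < real CARD('n::finite)" and "0 < c"
  shows
    "(\<exists>C>0. \<forall>(w :: real ^ 'n \<Rightarrow> real) x.
        w \<in> L_space \<alpha> \<and> spherically_antisymmetric \<alpha> w \<and> 1 < norm x \<and>
        ereal (w x) = (INF y\<in>{y. 1 \<le> norm y}. ereal (w y)) \<and> w x \<le> 0 \<and> C11_loc_at w x \<longrightarrow>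
        ereal (frac_laplacian c \<alpha> w x)
          \<le> ereal C * (ereal (w x / (sphere_dist x powr \<alpha> * (1 + sphere_dist x) ^ CARD('n)))
              + ereal_set_integral {y. 1 < norm y} (\<lambda>y. (w x - w y) * refl_kernel \<alpha> x y)) \<and>
        ereal (frac_laplacian c \<alpha> w x)
          \<le> - ereal C * ereal_set_integral {y. 1 < norm y} (\<lambda>y. w y * refl_kernel \<alpha> x y))
     \<and>
     (\<exists>C>0. \<forall>(w :: real ^ 'n \<Rightarrow> real) x.
        w \<in> L_space \<alpha> \<and> spherically_antisymmetric \<alpha> w \<and> 0 < norm x \<and> norm x < 1 \<and>
        ereal (w x) = (INF y\<in>{y. 0 < norm y \<and> norm y < 1}. ereal (w y)) \<and> w x \<le> 0 \<and>
        C11_loc_at w x \<longrightarrow>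
        ereal (frac_laplacian c \<alpha> w x)
          \<le> ereal C * (ereal (w x / sphere_dist x powr \<alpha>)
              + ereal_set_integral {y. norm y < 1} (\<lambda>y. (w x - w y) * refl_kernel \<alpha> x y)))"
proof -
  have inf: "w x \<le> w y" if "ereal (w x) = (INF y\<in>A. ereal (w y))" "y \<in> A"
    for w :: "real ^ 'n \<Rightarrow> real" and x y A
  proof -
    have "ereal (w x) \<le> ereal (w y)"
      unfolding that(1) by (rule INF_lower[OF that(2)])
    then show ?thesis
      by simp
  qed
  have \<omega>: "0 < measure lborel (ball (0 :: real ^ 'n) 1)"
    by simp
  show ?thesis
  proof (rule conjI; rule exI; intro conjI allI impI; (elim conjE)?)
    show "0 < c * min 1 (measure lborel (ball (0 :: real ^ 'n) 1) / 3 powr (real CARD('n) + \<alpha>))"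
      and "0 < c * min 1 (measure lborel (ball (0 :: real ^ 'n) 1) / 2 ^ CARD('n) / 2 powr (real CARD('n) + \<alpha>))"
      using assms(4) \<omega> by simp_all
  qed (rule frac_laplacian_le_exterior[OF assms(1,2,4)] frac_laplacian_le_interior[OF assms(1,2,4)]; auto dest: inf)+
qed

end
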